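(* Let $\omega\in\mathbb{R}$, $\lambda\in\mathbb{R}\setminus\{0\}$, $c\in\mathbb{C}$. Consider the local representation of $U_\lambda(\mathfrak{iso}_\omega(2))$ induced by the character $J^m\vdash1=c^m$ of the subalgebra $U(\mathfrak{so}_\omega(2))$ generated by $J$. Its carrier space consists of the elements $e^{c\varphi}\psi(a_1,a_2)$ with $\psi(a_1,a_2)\in U(\mathfrak{t}_{\lambda,2})$ and, identifying it with $U(\mathfrak{t}_{\lambda,2})$ through $\psi\mapsto e^{c\varphi}\psi$, the action of the generators is $$J\vdash\psi(a_1,a_2)=\Bigl[c-\bar a_1\frac{1-e^{-2\lambda\partial_{a_2}}}{2\lambda}+\omega\,\bar a_2\,\partial_{a_1}-\frac\lambda2\,\omega\,\bar a_1\,\partial_{a_1}^2\Bigr]\psi(a_1,a_2),$$ $$P_i\vdash\psi(a_1,a_2)=\partial_{a_i}\psi(a_1,a_2),\qquad i=1,2.$$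
   Context: The algebra $H=U_\lambda(\mathfrak{iso}_\omega(2))$ is the unital associative complex algebra generated by $J$ and the commutative subalgebra $\mathcal{L}=\mathbb{C}[P_1,P_2,e^{\pm\lambda P_2}]$ of functions on $\mathbb{R}^2$ (with $P_i(\alpha_1,\alpha_2)=\alpha_i$), subject to $[l,J]=\hat J(l)$ for $l\in\mathcal{L}$, where $\hat J$ is the derivation $$\hat J=-\Bigl[\frac{1-e^{-2\lambda P_2}}{2\lambda}+\frac12\lambda\omega P_1^2\Bigr]\frac{\partial}{\partial P_1}+\omega P_1\frac{\partial}{\partial P_2}.$$ As a vector space $H=\bigoplus_{m\ge0}J^m\mathcal{L}$. The dual Hopf algebra $F_\lambda(ISO_\omega(2))$ is generated by $\varphi,a_1,a_2$; its elements are written in the normal ordering $\varphi^qa_1^ra_2^s$, polynomially in $a_1,a_2$ with coefficients formal power series in $\varphi$ placed on the left. The pairing with $H$ is determined by $\langle J^mP_1^nP_2^p,\varphi^qa_1^ra_2^s\rangle=m!\,n!\,p!\,\delta_m^q\delta_n^r\delta_p^s$; for general $l\in\mathcal{L}$ it is $\langle J^ml,\varphi^qa_1^ra_2^s\rangle=m!\,\delta_m^q\,(\partial_1^r\partial_2^sl)(0,0)$. The regular actions are $\langle h',f\prec h\rangle=\langle hh',f\rangle$ and $\langle h',h\succ f\rangle=\langle h'h,f\rangle$ for $h,h'\in H$. $U(\mathfrak{t}_{\lambda,2})$ is the subalgebra of $F_\lambda(ISO_\omega(2))$ generated by $a_1,a_2$, with $[a_1,a_2]=\lambda a_1$; its elements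 $\psi(a_1,a_2)$ are linear combinations of ordered monomials $a_1^ra_2^s$. Local representation: the carrier space is the set of $f\in F_\lambda(ISO_\omega(2))$ with $f\prec J=c\,f$, and $h\in H$ acts on it by $h\vdash f=h\succ f$. Operators act on ordered monomials: $\bar a_1(a_1^ra_2^s)=a_1^{r+1}a_2^s$, $\bar a_2(a_1^ra_2^s)=a_1^ra_2^{s+1}$, and $\partial_{a_1},\partial_{a_2}$ are formal partial derivatives; $e^{-2\lambda\partial_{a_2}}$ is the exponential series. *)

theory Defs
  imports
    "HOL-Analysis.Analysis"
    "HOL-Library.Function_Algebras"
    "HOL-Library.Poly_Mapping"
    "HOL-Library.Groups_Big_Fun"
    "HOL-Computational_Algebra.Formal_Power_Series"
    "HOL-Algebra.Ring"
begin

section \<open>The algebra \<open>H\<close>\<close>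

type_synonym fn = "real \<Rightarrow> real \<Rightarrow> complex"

inductive_set Lalg :: "real \<Rightarrow> fn set" for lam :: real where
  const: "(\<lambda>x y. k) \<in> Lalg lam"
| P1: "(\<lambda>x y. of_real x) \<in> Lalg lam"
| P2: "(\<lambda>x y. of_real y) \<in> Lalg lam"
| exp_pos: "(\<lambda>x y. exp (of_real (lam * y))) \<in> Lalg lam"
| exp_neg: "(\<lambda>x y. exp (of_real (- lam * y))) \<in> Lalg lam"
| add: "f \<in> Lalg lam \<Longrightarrow> g \<in> Lalg lam \<Longrightarrow> f + g \<in> Lalg lam"
| mult: "f \<in> Lalg lam \<Longrightarrow> g \<in> Lalg lam \<Longrightarrow> f * g \<in> Lalg lam"

definition pd1 :: "fn \<Rightarrow> fn" where
  "pd1 l = (\<lambda>x y. vector_derivative (\<lambda>t. l t y) (at x))"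

definition pd2 :: "fn \<Rightarrow> fn" where
  "pd2 l = (\<lambda>x y. vector_derivative (\<lambda>t. l x t) (at y))"

definition Jhat :: "real \<Rightarrow> real \<Rightarrow> fn \<Rightarrow> fn" where
  "Jhat lam \<omega> l = (\<lambda>x y.
     - (of_real ((1 - exp (- 2 * lam * y)) / (2 * lam) + 1/2 * lam * \<omega> * x\<^sup>2) * pd1 l x y)
     + of_real (\<omega> * x) * pd2 l x y)"

text \<open>
  An element \<open>\<Sum>\<^sub>m J\<^sup>m l\<^sub>m\<close> of \<open>H = \<Oplus>\<^sub>m J\<^sup>m L\<close> is the finitely supported family
  \<open>m \<mapsto> l\<^sub>m\<close>; in particular \<open>J\<^sup>m l\<close> is \<open>Poly_Mapping.single m l\<close>. The relation
  \<open>l J = J l + Jhat l\<close> determines right multiplication by \<open>J\<close>, hence the product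
  \<open>h (\<Sum>\<^sub>n J\<^sup>n l\<^sub>n) = \<Sum>\<^sub>n (h J\<^sup>n) l\<^sub>n\<close>. The convolution product which the library puts on
  the type \<open>\<Rightarrow>\<^sub>0\<close> is not used anywhere.
\<close>

definition H_carrier :: "real \<Rightarrow> (nat \<Rightarrow>\<^sub>0 fn) set" where
  "H_carrier lam = {h. \<forall>m. Poly_Mapping.lookup h m \<in> Lalg lam}"

definition rmulL :: "(nat \<Rightarrow>\<^sub>0 fn) \<Rightarrow> fn \<Rightarrow> (nat \<Rightarrow>\<^sub>0 fn)" where
  "rmulL h l = Poly_Mapping.map (\<lambda>k. k * l) h"

definition rmulJ :: "real \<Rightarrow> real \<Rightarrow> (nat \<Rightarrow>\<^sub>0 fn) \<Rightarrow> (nat \<Rightarrow>\<^sub>0 fn)" where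
  "rmulJ lam \<omega> h = (\<Sum>m\<in>Poly_Mapping.keys h.
     Poly_Mapping.single (Suc m) (Poly_Mapping.lookup h m)
     + Poly_Mapping.single m (Jhat lam \<omega> (Poly_Mapping.lookup h m)))"

definition U_iso :: "real \<Rightarrow> real \<Rightarrow> (nat \<Rightarrow>\<^sub>0 fn) ring" where
  "U_iso lam \<omega> =
     \<lparr>carrier = H_carrier lam,
      monoid.mult = (\<lambda>h h'. \<Sum>n\<in>Poly_Mapping.keys h'.
        rmulL ((rmulJ lam \<omega> ^^ n) h) (Poly_Mapping.lookup h' n)),
      one = Poly_Mapping.single 0 1,
      zero = 0,
      add = (+)\<rparr>"

definition incL :: "fn \<Rightarrow> (nat \<Rightarrow>\<^sub>0 fn)" where
  "incL l = Poly_Mapping.single 0 l"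

definition gen_J :: "nat \<Rightarrow>\<^sub>0 fn" where
  "gen_J = Poly_Mapping.single 1 1"

definition gen_P1 :: "nat \<Rightarrow>\<^sub>0 fn" where
  "gen_P1 = incL (\<lambda>x y. of_real x)"

definition gen_P2 :: "nat \<Rightarrow>\<^sub>0 fn" where
  "gen_P2 = incL (\<lambda>x y. of_real y)"


section \<open>Normally ordered elements of the dual\<close>

text \<open>
  \<open>\<Sum> f\<^sub>r\<^sub>s(\<phi>) a\<^sub>1\<^sup>r a\<^sub>2\<^sup>s\<close> is the finitely supported family \<open>(r, s) \<mapsto> f\<^sub>r\<^sub>s\<close>. Power series in
  \<open>\<phi>\<close> multiply from the left, which is coefficientwise in the normal ordering.
\<close>

type_synonym dualF = "(nat \<times> nat) \<Rightarrow>\<^sub>0 complex fps"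

definition lmul :: "complex fps \<Rightarrow> dualF \<Rightarrow> dualF"  (infixr \<open>\<cdot>\<^sub>\<phi>\<close> 75) where
  "k \<cdot>\<^sub>\<phi> f = Poly_Mapping.map ((*) k) f"

abbreviation cmul :: "complex \<Rightarrow> dualF \<Rightarrow> dualF"  (infixr \<open>\<cdot>\<^sub>c\<close> 75) where
  "z \<cdot>\<^sub>c f \<equiv> fps_const z \<cdot>\<^sub>\<phi> f"

definition omon :: "nat \<Rightarrow> nat \<Rightarrow> dualF" where
  "omon r s = Poly_Mapping.single (r, s) 1"

text \<open>The \<open>\<complex>[[\<phi>]]\<close>-linear extension of a map given on the ordered monomials.\<close>

definition lin_ext :: "(nat \<Rightarrow> nat \<Rightarrow> dualF) \<Rightarrow> dualF \<Rightarrow> dualF" where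
  "lin_ext g f = (\<Sum>(r, s)\<in>Poly_Mapping.keys f. Poly_Mapping.lookup f (r, s) \<cdot>\<^sub>\<phi> g r s)"

definition abar1 :: "dualF \<Rightarrow> dualF" where
  "abar1 = lin_ext (\<lambda>r s. omon (Suc r) s)"

definition abar2 :: "dualF \<Rightarrow> dualF" where
  "abar2 = lin_ext (\<lambda>r s. omon r (Suc s))"

definition da1 :: "dualF \<Rightarrow> dualF" where
  "da1 = lin_ext (\<lambda>r s. of_nat r \<cdot>\<^sub>c omon (r - 1) s)"

definition da2 :: "dualF \<Rightarrow> dualF" where
  "da2 = lin_ext (\<lambda>r s. of_nat s \<cdot>\<^sub>c omon r (s - 1))"

text \<open>
  \<open>e\<^sup>z\<^sup>D\<close> for a locally nilpotent operator \<open>D\<close>: only finitely many terms of the series are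
  nonzero, which is what \<open>Sum_any\<close> requires.
\<close>

definition exp_op :: "complex \<Rightarrow> (dualF \<Rightarrow> dualF) \<Rightarrow> dualF \<Rightarrow> dualF" where
  "exp_op z D f = Sum_any (\<lambda>n. (z ^ n / fact n) \<cdot>\<^sub>c (D ^^ n) f)"

text \<open>
  \<open>U(t)\<close> consists of the elements with coefficients constant in \<open>\<phi>\<close>. By \<open>[a\<^sub>1, a\<^sub>2] = lam a\<^sub>1\<close>,
  left multiplication by \<open>a\<^sub>2\<close> sends \<open>a\<^sub>1\<^sup>r a\<^sub>2\<^sup>s\<close> to \<open>a\<^sub>1\<^sup>r a\<^sub>2\<^sup>s\<^sup>+\<^sup>1 - r lam a\<^sub>1\<^sup>r a\<^sub>2\<^sup>s\<close>, and left
  multiplication by \<open>a\<^sub>1\<close> is \<open>abar1\<close>.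
\<close>

definition lmul_a2 :: "real \<Rightarrow> dualF \<Rightarrow> dualF" where
  "lmul_a2 lam = lin_ext (\<lambda>r s. omon r (Suc s) - (of_nat r * of_real lam) \<cdot>\<^sub>c omon r s)"

definition U_t :: "real \<Rightarrow> dualF ring" where
  "U_t lam =
     \<lparr>carrier = {\<psi>. \<forall>k. \<exists>z. Poly_Mapping.lookup \<psi> k = fps_const z},
      monoid.mult = (\<lambda>\<psi> \<psi>'. lin_ext (\<lambda>r s. (abar1 ^^ r) ((lmul_a2 lam ^^ s) \<psi>')) \<psi>),
      one = omon 0 0,
      zero = 0,
      add = (+)\<rparr>"


section \<open>Pairing, regular actions, local representation\<close>

definition pairing :: "(nat \<Rightarrow>\<^sub>0 fn) \<Rightarrow> dualF \<Rightarrow> complex" where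
  "pairing h f = (\<Sum>m\<in>Poly_Mapping.keys h. \<Sum>(r, s)\<in>Poly_Mapping.keys f.
     fact m * fps_nth (Poly_Mapping.lookup f (r, s)) m
     * (pd1 ^^ r) ((pd2 ^^ s) (Poly_Mapping.lookup h m)) 0 0)"

text \<open>
  The descriptions below are unique because the pairing separates the elements of the dual
  (\<open>pairing_nondegenerate\<close>).
\<close>

definition right_act :: "real \<Rightarrow> real \<Rightarrow> dualF \<Rightarrow> (nat \<Rightarrow>\<^sub>0 fn) \<Rightarrow> dualF" where
  "right_act lam \<omega> f h = (THE g. \<forall>h'\<in>carrier (U_iso lam \<omega>).
     pairing h' g = pairing (h \<otimes>\<^bsub>U_iso lam \<omega>\<^esub> h') f)"

definition left_act :: "real \<Rightarrow> real \<Rightarrow> (nat \<Rightarrow>\<^sub>0 fn) \<Rightarrow> dualF \<Rightarrow> dualF" where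
  "left_act lam \<omega> h f = (THE g. \<forall>h'\<in>carrier (U_iso lam \<omega>).
     pairing h' g = pairing (h' \<otimes>\<^bsub>U_iso lam \<omega>\<^esub> h) f)"

definition local_rep_space :: "real \<Rightarrow> real \<Rightarrow> complex \<Rightarrow> dualF set" where
  "local_rep_space lam \<omega> c = {f. right_act lam \<omega> f gen_J = c \<cdot>\<^sub>c f}"

definition local_rep_act :: "real \<Rightarrow> real \<Rightarrow> (nat \<Rightarrow>\<^sub>0 fn) \<Rightarrow> dualF \<Rightarrow> dualF" where
  "local_rep_act lam \<omega> h f = left_act lam \<omega> h f"

definition exp_emb :: "complex \<Rightarrow> dualF \<Rightarrow> dualF" where
  "exp_emb c \<psi> = fps_exp c \<cdot>\<^sub>\<phi> \<psi>"


section \<open>Consistency of the definitions\<close>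

subsection \<open>\<open>H\<close> is the algebra presented by \<open>[l, J] = Jhat l\<close>\<close>

lemma Lalg_zero: "0 \<in> Lalg lam" and Lalg_one: "1 \<in> Lalg lam"
  using Lalg.const[of 0 lam] Lalg.const[of 1 lam] by (simp_all add: zero_fun_def one_fun_def)

lemma Lalg_uminus: "f \<in> Lalg lam \<Longrightarrow> - f \<in> Lalg lam"
  using Lalg.mult[OF Lalg.const[of "-1" lam], of f]
  by (simp add: times_fun_def fun_Compl_def)

lemma Lalg_derivs:
  assumes "f \<in> Lalg lam"
  shows "\<exists>f1\<in>Lalg lam. \<exists>f2\<in>Lalg lam. \<forall>x y.
    ((\<lambda>t. f t y) has_vector_derivative f1 x y) (at x) \<and>
    ((\<lambda>t. f x t) has_vector_derivative f2 x y) (at y)"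
  using assms
proof induction
  case (const k)
  show ?case
    by (intro bexI[of _ "\<lambda>x y. 0"]) (auto intro!: derivative_eq_intros Lalg.const)
next
  case P1
  have "(of_real has_vector_derivative 1) (at x)" for x :: real
    by (auto intro!: derivative_eq_intros simp: has_vector_derivative_def scaleR_conv_of_real)
  then show ?case
    by (intro bexI[of _ "\<lambda>x y. 1"] bexI[of _ "\<lambda>x y. 0"])
       (auto intro!: derivative_eq_intros Lalg.const)
next
  case P2
  have "(of_real has_vector_derivative 1) (at x)" for x :: real
    by (auto intro!: derivative_eq_intros simp: has_vector_derivative_def scaleR_conv_of_real)
  then show ?case
    by (intro bexI[of _ "\<lambda>x y. 1"] bexI[of _ "\<lambda>x y. 0"])
       (auto intro!: derivative_eq_intros Lalg.const)
next
  case exp_pos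
  have e: "((\<lambda>t. exp (of_real (lam * t)) :: complex) has_vector_derivative
        of_real lam * exp (of_real (lam * x))) (at x)" for x
  proof -
    have "((\<lambda>t. exp (lam * t)) has_real_derivative lam * exp (lam * x)) (at x)"
      by (auto intro!: derivative_eq_intros)
    then have "((\<lambda>t. of_real (exp (lam * t)) :: complex) has_vector_derivative
        of_real (lam * exp (lam * x))) (at x)"
      by (intro has_vector_derivative_of_real)
         (simp add: has_real_derivative_iff_has_vector_derivative)
    then show ?thesis
      unfolding exp_of_real of_real_mult[of "lam" "exp (lam * x)"] .
  qed
  have m: "(\<lambda>x y. of_real lam * exp (of_real (lam * y))) \<in> Lalg lam"
    using Lalg.mult[OF Lalg.const[of "of_real lam" lam] Lalg.exp_pos] by (simp add: times_fun_def)
  show ?case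
    by (rule bexI[OF _ Lalg.const[of 0]], rule bexI[OF _ m]) (use e in auto)
next
  case exp_neg
  have e: "((\<lambda>t. exp (of_real (- lam * t)) :: complex) has_vector_derivative
        of_real (- lam) * exp (of_real (- lam * x))) (at x)" for x
  proof -
    have "((\<lambda>t. exp (- lam * t)) has_real_derivative - lam * exp (- lam * x)) (at x)"
      by (auto intro!: derivative_eq_intros)
    then have "((\<lambda>t. of_real (exp (- lam * t)) :: complex) has_vector_derivative
        of_real (- lam * exp (- lam * x))) (at x)"
      by (intro has_vector_derivative_of_real)
         (simp add: has_real_derivative_iff_has_vector_derivative)
    then show ?thesis
      unfolding exp_of_real of_real_mult[of "- lam" "exp (- lam * x)"] .
  qed
  have m: "(\<lambda>x y. of_real (- lam) * exp (of_real (- lam * y))) \<in> Lalg lam"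
    using Lalg.mult[OF Lalg.const[of "of_real (- lam)" lam] Lalg.exp_neg]
    by (simp add: times_fun_def)
  show ?case
    by (rule bexI[OF _ Lalg.const[of 0]], rule bexI[OF _ m]) (use e in auto)
next
  case (add f g)
  then obtain f1 f2 g1 g2 where *: "f1 \<in> Lalg lam" "f2 \<in> Lalg lam" "g1 \<in> Lalg lam" "g2 \<in> Lalg lam"
    "\<And>x y. ((\<lambda>t. f t y) has_vector_derivative f1 x y) (at x)"
    "\<And>x y. ((\<lambda>t. f x t) has_vector_derivative f2 x y) (at y)"
    "\<And>x y. ((\<lambda>t. g t y) has_vector_derivative g1 x y) (at x)"
    "\<And>x y. ((\<lambda>t. g x t) has_vector_derivative g2 x y) (at y)"
    by metis
  show ?case
    by (rule bexI[of _ "f1 + g1"], rule bexI[of _ "f2 + g2"])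
       (auto intro!: Lalg.add * has_vector_derivative_add)
next
  case (mult f g)
  then obtain f1 f2 g1 g2 where *: "f1 \<in> Lalg lam" "f2 \<in> Lalg lam" "g1 \<in> Lalg lam" "g2 \<in> Lalg lam"
    "\<And>x y. ((\<lambda>t. f t y) has_vector_derivative f1 x y) (at x)"
    "\<And>x y. ((\<lambda>t. f x t) has_vector_derivative f2 x y) (at y)"
    "\<And>x y. ((\<lambda>t. g t y) has_vector_derivative g1 x y) (at x)"
    "\<And>x y. ((\<lambda>t. g x t) has_vector_derivative g2 x y) (at y)"
    by metis
  show ?case
    by (rule bexI[of _ "f * g1 + f1 * g"], rule bexI[of _ "f * g2 + f2 * g"])
       (auto intro!: Lalg.add Lalg.mult mult * has_vector_derivative_mult)
qed

lemma Lalg_pd: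
  assumes "f \<in> Lalg lam"
  shows Lalg_pd1: "pd1 f \<in> Lalg lam" and Lalg_pd2: "pd2 f \<in> Lalg lam"
    and Lalg_has_pd1: "((\<lambda>t. f t y) has_vector_derivative pd1 f x y) (at x)"
    and Lalg_has_pd2: "((\<lambda>t. f x t) has_vector_derivative pd2 f x y) (at y)"
proof -
  obtain f1 f2 where *: "f1 \<in> Lalg lam" "f2 \<in> Lalg lam"
    "\<And>x y. ((\<lambda>t. f t y) has_vector_derivative f1 x y) (at x)"
    "\<And>x y. ((\<lambda>t. f x t) has_vector_derivative f2 x y) (at y)"
    using Lalg_derivs[OF assms] by metis
  have "pd1 f = f1" "pd2 f = f2"
    by (auto simp: pd1_def pd2_def fun_eq_iff intro!: vector_derivative_at *)
  with * show "pd1 f \<in> Lalg lam" "pd2 f \<in> Lalg lam"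
    "((\<lambda>t. f t y) has_vector_derivative pd1 f x y) (at x)"
    "((\<lambda>t. f x t) has_vector_derivative pd2 f x y) (at y)" by auto
qed

lemma pd_add:
  assumes "f \<in> Lalg lam" "g \<in> Lalg lam"
  shows "pd1 (f + g) = pd1 f + pd1 g" "pd2 (f + g) = pd2 f + pd2 g"
  by (auto simp: fun_eq_iff pd1_def[of "f + g"] pd2_def[of "f + g"]
      intro!: vector_derivative_at has_vector_derivative_add Lalg_has_pd1 Lalg_has_pd2 assms)

lemma pd_mult:
  assumes "f \<in> Lalg lam" "g \<in> Lalg lam"
  shows "pd1 (f * g) = f * pd1 g + pd1 f * g" "pd2 (f * g) = f * pd2 g + pd2 f * g"
  by (auto simp: fun_eq_iff pd1_def[of "f * g"] pd2_def[of "f * g"]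
      intro!: vector_derivative_at has_vector_derivative_mult Lalg_has_pd1 Lalg_has_pd2 assms)

lemma Jhat_Lalg:
  assumes "f \<in> Lalg lam"
  shows "Jhat lam \<omega> f \<in> Lalg lam"
proof -
  let ?E = "\<lambda>x y. exp (of_real (- lam * y)) :: complex"
  let ?X = "\<lambda>x y. of_real x :: complex"
  let ?K = "\<lambda>k x y. k :: complex"
  have "Jhat lam \<omega> f = - ((?K (1 / (2 * of_real lam)) * (1 + - (?E * ?E))
      + ?K (of_real (lam * \<omega> / 2)) * (?X * ?X)) * pd1 f) + (?K (of_real \<omega>) * ?X) * pd2 f"
  proof (intro ext)
    fix x y
    have e: "exp (- 2 * lam * y) = exp (- lam * y) * exp (- lam * y)"
      by (simp add: mult_exp_exp)
    have E: "?E x y = of_real (exp (- lam * y))"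
      by (rule exp_of_real)
    show "Jhat lam \<omega> f x y = (- ((?K (1 / (2 * of_real lam)) * (1 + - (?E * ?E))
        + ?K (of_real (lam * \<omega> / 2)) * (?X * ?X)) * pd1 f) + (?K (of_real \<omega>) * ?X) * pd2 f) x y"
      unfolding Jhat_def e plus_fun_apply times_fun_apply uminus_apply one_fun_apply E
      by (simp add: power2_eq_square)
  qed
  also have "\<dots> \<in> Lalg lam"
    by (intro Lalg.add Lalg_uminus Lalg.mult Lalg.const Lalg.P1 Lalg.exp_neg Lalg_one
        Lalg_pd1 Lalg_pd2 assms)
  finally show ?thesis .
qed

lemma Jhat_vector_field: "\<exists>A B. \<forall>l. Jhat lam \<omega> l = A * pd1 l + B * pd2 l"
  by (rule exI[of _ "\<lambda>x y. - of_real ((1 - exp (- 2 * lam * y)) / (2 * lam) + 1/2 * lam * \<omega> * x\<^sup>2)"],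
      rule exI[of _ "\<lambda>x y. of_real (\<omega> * x)"]) (simp add: Jhat_def fun_eq_iff del: of_real_add of_real_divide of_real_mult of_real_diff)

lemma Jhat_add:
  assumes "f \<in> Lalg lam" "g \<in> Lalg lam"
  shows "Jhat lam \<omega> (f + g) = Jhat lam \<omega> f + Jhat lam \<omega> g"
proof -
  obtain A B where "\<And>l. Jhat lam \<omega> l = A * pd1 l + B * pd2 l"
    using Jhat_vector_field by metis
  then show ?thesis by (simp add: pd_add[OF assms] algebra_simps)
qed

lemma Jhat_mult:
  assumes "f \<in> Lalg lam" "g \<in> Lalg lam"
  shows "Jhat lam \<omega> (f * g) = Jhat lam \<omega> f * g + f * Jhat lam \<omega> g"
proof -
  obtain A B where "\<And>l. Jhat lam \<omega> l = A * pd1 l + B * pd2 l"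
    using Jhat_vector_field by metis
  then show ?thesis by (simp add: pd_mult[OF assms] algebra_simps)
qed

lemma Jhat_0 [simp]: "Jhat lam \<omega> 0 = 0"
  by (simp add: Jhat_def fun_eq_iff pd1_def pd2_def)

lemma Jhat_1 [simp]: "Jhat lam \<omega> 1 = 0"
  by (simp add: Jhat_def fun_eq_iff pd1_def pd2_def)

lemma lookup_rmulL: "Poly_Mapping.lookup (rmulL h l) m = Poly_Mapping.lookup h m * l"
  by (simp add: rmulL_def Poly_Mapping.map.rep_eq when_def)

lemma lookup_rmulJ:
  "Poly_Mapping.lookup (rmulJ lam \<omega> h) m =
     (case m of 0 \<Rightarrow> 0 | Suc k \<Rightarrow> Poly_Mapping.lookup h k)
     + Jhat lam \<omega> (Poly_Mapping.lookup h m)"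
proof -
  have "(\<Sum>k\<in>Poly_Mapping.keys h. Poly_Mapping.lookup (Poly_Mapping.single (Suc k)
          (Poly_Mapping.lookup h k)) m) = (case m of 0 \<Rightarrow> 0 | Suc k \<Rightarrow> Poly_Mapping.lookup h k)"
    by (cases m) (auto simp: lookup_single when_def sum.delta in_keys_iff)
  moreover have "(\<Sum>k\<in>Poly_Mapping.keys h. Poly_Mapping.lookup (Poly_Mapping.single k
          (Jhat lam \<omega> (Poly_Mapping.lookup h k))) m) = Jhat lam \<omega> (Poly_Mapping.lookup h m)"
    by (auto simp: lookup_single when_def sum.delta in_keys_iff)
  ultimately show ?thesis
    by (simp add: rmulJ_def lookup_sum lookup_add sum.distrib)
qed

lemma H_carrier_add: "g \<in> H_carrier lam \<Longrightarrow> h \<in> H_carrier lam \<Longrightarrow> g + h \<in> H_carrier lam"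
  by (auto simp: H_carrier_def lookup_add intro: Lalg.add)

lemma H_carrier_zero: "0 \<in> H_carrier lam"
  by (auto simp: H_carrier_def Lalg_zero)

lemma H_carrier_sum: "(\<And>i. i \<in> A \<Longrightarrow> f i \<in> H_carrier lam) \<Longrightarrow> sum f A \<in> H_carrier lam"
  by (induction A rule: infinite_finite_induct) (auto intro: H_carrier_add H_carrier_zero)

lemma H_carrier_single: "l \<in> Lalg lam \<Longrightarrow> Poly_Mapping.single m l \<in> H_carrier lam"
  by (auto simp: H_carrier_def lookup_single when_def Lalg_zero)

lemma H_carrier_rmulL: "h \<in> H_carrier lam \<Longrightarrow> l \<in> Lalg lam \<Longrightarrow> rmulL h l \<in> H_carrier lam"
  by (auto simp: H_carrier_def lookup_rmulL intro: Lalg.mult)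

lemma H_carrier_rmulJ: "h \<in> H_carrier lam \<Longrightarrow> rmulJ lam \<omega> h \<in> H_carrier lam"
  by (auto simp: H_carrier_def lookup_rmulJ Lalg_zero
      intro!: Lalg.add Jhat_Lalg split: nat.split)

lemma H_carrier_rmulJ_pow: "h \<in> H_carrier lam \<Longrightarrow> (rmulJ lam \<omega> ^^ n) h \<in> H_carrier lam"
  by (induction n) (auto intro: H_carrier_rmulJ)

lemma rmulJ_add:
  "g \<in> H_carrier lam \<Longrightarrow> h \<in> H_carrier lam \<Longrightarrow>
     rmulJ lam \<omega> (g + h) = rmulJ lam \<omega> g + rmulJ lam \<omega> h"
  by (rule poly_mapping_eqI)
     (auto simp: lookup_rmulJ lookup_add H_carrier_def Jhat_add split: nat.split)

lemma rmulJ_0 [simp]: "rmulJ lam \<omega> 0 = 0"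
  by (simp add: rmulJ_def)

lemma rmulJ_pow_0 [simp]: "(rmulJ lam \<omega> ^^ n) 0 = 0"
  by (induction n) auto

lemma rmulJ_pow_add:
  "g \<in> H_carrier lam \<Longrightarrow> h \<in> H_carrier lam \<Longrightarrow>
     (rmulJ lam \<omega> ^^ n) (g + h) = (rmulJ lam \<omega> ^^ n) g + (rmulJ lam \<omega> ^^ n) h"
  by (induction n) (auto simp: rmulJ_add H_carrier_rmulJ_pow)

lemma rmulJ_sum:
  "(\<And>i. i \<in> A \<Longrightarrow> f i \<in> H_carrier lam) \<Longrightarrow>
     rmulJ lam \<omega> (sum f A) = (\<Sum>i\<in>A. rmulJ lam \<omega> (f i))"
  by (induction A rule: infinite_finite_induct) (auto simp: rmulJ_add H_carrier_sum)

lemma rmulL_add: "rmulL (g + h) l = rmulL g l + rmulL h l"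
  and rmulL_add_right: "rmulL g (l + l') = rmulL g l + rmulL g l'"
  and rmulL_rmulL: "rmulL (rmulL g l) l' = rmulL g (l * l')"
  and rmulL_0 [simp]: "rmulL 0 l = 0"
  and rmulL_0_right [simp]: "rmulL g 0 = 0"
  and rmulL_1 [simp]: "rmulL g 1 = g"
  by (auto intro!: poly_mapping_eqI simp: lookup_rmulL lookup_add distrib_right distrib_left mult.assoc)

lemma rmulL_sum: "rmulL (sum f A) l = (\<Sum>i\<in>A. rmulL (f i) l)"
  by (induction A rule: infinite_finite_induct) (auto simp: rmulL_add)

lemma rmulJ_rmulL:
  "h \<in> H_carrier lam \<Longrightarrow> l \<in> Lalg lam \<Longrightarrow>
     rmulJ lam \<omega> (rmulL h l) = rmulL (rmulJ lam \<omega> h) l + rmulL h (Jhat lam \<omega> l)"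
  by (rule poly_mapping_eqI)
     (auto simp: lookup_rmulJ lookup_rmulL lookup_add H_carrier_def Jhat_mult algebra_simps
       split: nat.split)

lemma rmulJ_single:
  "rmulJ lam \<omega> (Poly_Mapping.single m l)
     = Poly_Mapping.single (Suc m) l + Poly_Mapping.single m (Jhat lam \<omega> l)"
  by (cases "l = 0") (auto simp: rmulJ_def)

lemma rmulL_single: "rmulL (Poly_Mapping.single m k) l = Poly_Mapping.single m (k * l)"
  by (auto intro!: poly_mapping_eqI simp: lookup_rmulL lookup_single when_def)

lemma rmulJ_pow_one: "(rmulJ lam \<omega> ^^ n) (Poly_Mapping.single m 1) = Poly_Mapping.single (m + n) 1"
  by (induction n) (simp_all only: funpow_0 funpow.simps(2) o_apply rmulJ_single Jhat_1 single_zero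
      add_0_right add_Suc_right)

lemma poly_mapping_sum_single:
  "(\<Sum>k\<in>Poly_Mapping.keys h. Poly_Mapping.single k (Poly_Mapping.lookup h k)) = h"
  by (rule poly_mapping_eqI) (auto simp: lookup_sum lookup_single when_def sum.delta in_keys_iff)

abbreviation H_mult :: "real \<Rightarrow> real \<Rightarrow> (nat \<Rightarrow>\<^sub>0 fn) \<Rightarrow> (nat \<Rightarrow>\<^sub>0 fn) \<Rightarrow> (nat \<Rightarrow>\<^sub>0 fn)" where
  "H_mult lam \<omega> g h \<equiv> g \<otimes>\<^bsub>U_iso lam \<omega>\<^esub> h"

lemma H_mult_superset:
  assumes "finite A" "Poly_Mapping.keys h \<subseteq> A"
  shows "H_mult lam \<omega> g h = (\<Sum>n\<in>A. rmulL ((rmulJ lam \<omega> ^^ n) g) (Poly_Mapping.lookup h n))"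
  unfolding U_iso_def monoid.simps
  by (rule sum.mono_neutral_left) (use assms in \<open>auto simp: in_keys_iff\<close>)

lemma H_mult_add_right: "H_mult lam \<omega> f (g + h) = H_mult lam \<omega> f g + H_mult lam \<omega> f h"
proof -
  let ?A = "Poly_Mapping.keys g \<union> Poly_Mapping.keys h"
  have "Poly_Mapping.keys (g + h) \<subseteq> ?A" by (rule keys_add)
  then show ?thesis
    by (simp add: H_mult_superset[of ?A] lookup_add rmulL_add_right sum.distrib)
qed

lemma H_mult_0_right [simp]: "H_mult lam \<omega> f 0 = 0"
  by (simp add: U_iso_def)

lemma H_mult_sum_right: "H_mult lam \<omega> f (sum g A) = (\<Sum>i\<in>A. H_mult lam \<omega> f (g i))"
  by (induction A rule: infinite_finite_induct) (auto simp: H_mult_add_right)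

lemma H_mult_single: "H_mult lam \<omega> f (Poly_Mapping.single n l) = rmulL ((rmulJ lam \<omega> ^^ n) f) l"
  by (subst H_mult_superset[of "{n}"]) auto

lemma H_mult_add_left:
  "f \<in> H_carrier lam \<Longrightarrow> g \<in> H_carrier lam \<Longrightarrow>
     H_mult lam \<omega> (f + g) h = H_mult lam \<omega> f h + H_mult lam \<omega> g h"
  by (simp add: U_iso_def rmulJ_pow_add rmulL_add sum.distrib)

lemma H_mult_closed:
  "f \<in> H_carrier lam \<Longrightarrow> g \<in> H_carrier lam \<Longrightarrow> H_mult lam \<omega> f g \<in> H_carrier lam"
  unfolding U_iso_def monoid.simps
  by (intro H_carrier_sum H_carrier_rmulL H_carrier_rmulJ_pow) (auto simp: H_carrier_def)

lemma H_mult_rmulL: "H_mult lam \<omega> f (rmulL g l) = rmulL (H_mult lam \<omega> f g) l"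
proof -
  have "Poly_Mapping.keys (rmulL g l) \<subseteq> Poly_Mapping.keys g"
    by (auto simp: in_keys_iff lookup_rmulL)
  then show ?thesis
    by (simp add: H_mult_superset[of "Poly_Mapping.keys g"] lookup_rmulL rmulL_sum rmulL_rmulL)
qed

lemma H_mult_rmulJ:
  assumes "f \<in> H_carrier lam" "g \<in> H_carrier lam"
  shows "H_mult lam \<omega> f (rmulJ lam \<omega> g) = rmulJ lam \<omega> (H_mult lam \<omega> f g)"
proof -
  have L: "Poly_Mapping.lookup g n \<in> Lalg lam" for n using assms by (auto simp: H_carrier_def)
  have "H_mult lam \<omega> f (rmulJ lam \<omega> g) = (\<Sum>n\<in>Poly_Mapping.keys g.
      rmulL ((rmulJ lam \<omega> ^^ Suc n) f) (Poly_Mapping.lookup g n)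
      + rmulL ((rmulJ lam \<omega> ^^ n) f) (Jhat lam \<omega> (Poly_Mapping.lookup g n)))"
    by (simp add: rmulJ_def[of _ _ g] H_mult_sum_right H_mult_add_right H_mult_single)
  also have "\<dots> = (\<Sum>n\<in>Poly_Mapping.keys g.
      rmulJ lam \<omega> (rmulL ((rmulJ lam \<omega> ^^ n) f) (Poly_Mapping.lookup g n)))"
    by (simp add: rmulJ_rmulL[OF H_carrier_rmulJ_pow[OF assms(1)] L])
  also have "\<dots> = rmulJ lam \<omega> (H_mult lam \<omega> f g)"
    by (subst rmulJ_sum[symmetric])
       (auto simp: U_iso_def intro!: H_carrier_rmulL H_carrier_rmulJ_pow assms L)
  finally show ?thesis .
qed

lemma H_mult_rmulJ_pow:
  "f \<in> H_carrier lam \<Longrightarrow> g \<in> H_carrier lam \<Longrightarrow>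
     H_mult lam \<omega> f ((rmulJ lam \<omega> ^^ n) g) = (rmulJ lam \<omega> ^^ n) (H_mult lam \<omega> f g)"
  by (induction n) (auto simp: H_mult_rmulJ H_carrier_rmulJ_pow)

lemma H_mult_assoc:
  assumes "f \<in> H_carrier lam" "g \<in> H_carrier lam"
  shows "H_mult lam \<omega> (H_mult lam \<omega> f g) h = H_mult lam \<omega> f (H_mult lam \<omega> g h)"
proof -
  have "H_mult lam \<omega> (H_mult lam \<omega> f g) h = (\<Sum>n\<in>Poly_Mapping.keys h.
      rmulL (H_mult lam \<omega> f ((rmulJ lam \<omega> ^^ n) g)) (Poly_Mapping.lookup h n))"
    by (simp only: H_mult_rmulJ_pow[OF assms] H_mult_superset[OF finite_keys order_refl, of _ _ _ h])
  also have "\<dots> = H_mult lam \<omega> f (H_mult lam \<omega> g h)"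
    by (simp only: H_mult_rmulL[symmetric] H_mult_sum_right[symmetric]
        H_mult_superset[OF finite_keys order_refl, of _ _ _ h])
  finally show ?thesis .
qed

lemma H_mult_one_left: "H_mult lam \<omega> (Poly_Mapping.single 0 1) h = h"
  unfolding U_iso_def monoid.simps
  by (simp only: rmulJ_pow_one rmulL_single add_0_left mult_1_left poly_mapping_sum_single)

lemma H_mult_one_right: "H_mult lam \<omega> h (Poly_Mapping.single 0 1) = h"
  by (simp only: H_mult_single funpow_0 rmulL_1)

theorem ring_U_iso: "ring (U_iso lam \<omega>)"
proof (rule ringI)
  show "abelian_group (U_iso lam \<omega>)"
  proof (rule abelian_groupI)
    fix x assume "x \<in> carrier (U_iso lam \<omega>)"
    then have "- x \<in> carrier (U_iso lam \<omega>)"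
      by (auto simp: U_iso_def H_carrier_def intro: Lalg_uminus)
    then show "\<exists>y\<in>carrier (U_iso lam \<omega>). y \<oplus>\<^bsub>U_iso lam \<omega>\<^esub> x = \<zero>\<^bsub>U_iso lam \<omega>\<^esub>"
      by (rule bexI[rotated]) (simp add: U_iso_def)
  qed (auto simp: U_iso_def H_carrier_add H_carrier_zero algebra_simps)
  have c: "carrier (U_iso lam \<omega>) = H_carrier lam" and o: "\<one>\<^bsub>U_iso lam \<omega>\<^esub> = Poly_Mapping.single 0 1"
    and a: "(\<oplus>\<^bsub>U_iso lam \<omega>\<^esub>) = (+)"
    by (simp_all add: U_iso_def)
  show "monoid (U_iso lam \<omega>)"
  proof (rule monoidI; unfold c o)
    show "Poly_Mapping.single 0 1 \<in> H_carrier lam"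
      by (rule H_carrier_single[OF Lalg_one])
  qed (rule H_mult_closed H_mult_assoc H_mult_one_left H_mult_one_right; assumption)+
  fix x y z
  assume "x \<in> carrier (U_iso lam \<omega>)" "y \<in> carrier (U_iso lam \<omega>)" "z \<in> carrier (U_iso lam \<omega>)"
  then show "(x \<oplus>\<^bsub>U_iso lam \<omega>\<^esub> y) \<otimes>\<^bsub>U_iso lam \<omega>\<^esub> z
      = x \<otimes>\<^bsub>U_iso lam \<omega>\<^esub> z \<oplus>\<^bsub>U_iso lam \<omega>\<^esub> y \<otimes>\<^bsub>U_iso lam \<omega>\<^esub> z"
    "z \<otimes>\<^bsub>U_iso lam \<omega>\<^esub> (x \<oplus>\<^bsub>U_iso lam \<omega>\<^esub> y)
      = z \<otimes>\<^bsub>U_iso lam \<omega>\<^esub> x \<oplus>\<^bsub>U_iso lam \<omega>\<^esub> z \<otimes>\<^bsub>U_iso lam \<omega>\<^esub> y"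
    unfolding a c by (auto intro: H_mult_add_left H_mult_add_right)
qed

theorem U_iso_relation:
  assumes "l \<in> Lalg lam"
  shows "incL l \<otimes>\<^bsub>U_iso lam \<omega>\<^esub> gen_J \<ominus>\<^bsub>U_iso lam \<omega>\<^esub> gen_J \<otimes>\<^bsub>U_iso lam \<omega>\<^esub> incL l = incL (Jhat lam \<omega> l)"
proof -
  interpret ring "U_iso lam \<omega>" by (rule ring_U_iso)
  have 1: "incL l \<otimes>\<^bsub>U_iso lam \<omega>\<^esub> gen_J = Poly_Mapping.single 1 l + incL (Jhat lam \<omega> l)"
    by (simp add: incL_def gen_J_def H_mult_single rmulJ_single)
  have 2: "gen_J \<otimes>\<^bsub>U_iso lam \<omega>\<^esub> incL l = Poly_Mapping.single 1 l"
    by (simp add: incL_def gen_J_def H_mult_single rmulL_single)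
  have car: "Poly_Mapping.single 1 l \<in> carrier (U_iso lam \<omega>)"
    "incL (Jhat lam \<omega> l) \<in> carrier (U_iso lam \<omega>)"
    by (auto simp: U_iso_def incL_def intro!: H_carrier_single assms Jhat_Lalg)
  have "Poly_Mapping.single 1 l + incL (Jhat lam \<omega> l)
      = Poly_Mapping.single 1 l \<oplus>\<^bsub>U_iso lam \<omega>\<^esub> incL (Jhat lam \<omega> l)"
    by (simp add: U_iso_def)
  then show ?thesis
    unfolding 1 2 using car by algebra
qed

theorem U_iso_normal_form:
  "gen_J [^]\<^bsub>U_iso lam \<omega>\<^esub> (m::nat) \<otimes>\<^bsub>U_iso lam \<omega>\<^esub> incL l = Poly_Mapping.single m l"
proof -
  have "gen_J [^]\<^bsub>U_iso lam \<omega>\<^esub> m = Poly_Mapping.single m 1"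
  proof (induction m)
    case 0
    show ?case
      unfolding nat_pow_0 by (simp only: U_iso_def monoid.simps)
  next
    case (Suc m)
    then show ?case
      by (simp only: nat_pow_Suc gen_J_def H_mult_single One_nat_def funpow.simps(2) o_apply
          funpow_0 rmulJ_single Jhat_1 single_zero add_0_right rmulL_1)
  qed
  then show ?thesis
    by (simp add: incL_def H_mult_single rmulL_single)
qed

theorem incL_hom:
  "incL (l + l') = incL l \<oplus>\<^bsub>U_iso lam \<omega>\<^esub> incL l'"
  "incL (l * l') = incL l \<otimes>\<^bsub>U_iso lam \<omega>\<^esub> incL l'"
  "incL 1 = \<one>\<^bsub>U_iso lam \<omega>\<^esub>"
proof -
  show "incL (l + l') = incL l \<oplus>\<^bsub>U_iso lam \<omega>\<^esub> incL l'"
    by (simp add: incL_def single_add U_iso_def)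
  show "incL (l * l') = incL l \<otimes>\<^bsub>U_iso lam \<omega>\<^esub> incL l'"
    by (simp add: incL_def H_mult_single rmulL_single)
  show "incL 1 = \<one>\<^bsub>U_iso lam \<omega>\<^esub>"
    by (simp add: incL_def U_iso_def)
qed


subsection \<open>\<open>U(t)\<close> is the algebra with \<open>[a\<^sub>1, a\<^sub>2] = lam a\<^sub>1\<close>\<close>

lemma lookup_lmul: "Poly_Mapping.lookup (k \<cdot>\<^sub>\<phi> f) x = k * Poly_Mapping.lookup f x"
  by (simp add: lmul_def Poly_Mapping.map.rep_eq when_def)

lemma lmul_simps [simp]:
  "1 \<cdot>\<^sub>\<phi> f = f" "0 \<cdot>\<^sub>\<phi> f = 0" "k \<cdot>\<^sub>\<phi> 0 = 0"
  by (auto intro!: poly_mapping_eqI simp: lookup_lmul)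

lemma lmul_add: "k \<cdot>\<^sub>\<phi> (f + g) = k \<cdot>\<^sub>\<phi> f + k \<cdot>\<^sub>\<phi> g"
  and lmul_diff: "k \<cdot>\<^sub>\<phi> (f - g) = k \<cdot>\<^sub>\<phi> f - k \<cdot>\<^sub>\<phi> g"
  and lmul_add_left: "(k + k') \<cdot>\<^sub>\<phi> f = k \<cdot>\<^sub>\<phi> f + k' \<cdot>\<^sub>\<phi> f"
  and lmul_lmul: "k \<cdot>\<^sub>\<phi> k' \<cdot>\<^sub>\<phi> f = (k * k') \<cdot>\<^sub>\<phi> f"
  by (auto intro!: poly_mapping_eqI
      simp: lookup_lmul lookup_add lookup_minus distrib_left distrib_right right_diff_distrib mult.assoc)

lemma lmul_sum: "k \<cdot>\<^sub>\<phi> sum f A = (\<Sum>i\<in>A. k \<cdot>\<^sub>\<phi> f i)"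
  by (induction A rule: infinite_finite_induct) (auto simp: lmul_add)

definition phi_linear :: "(dualF \<Rightarrow> dualF) \<Rightarrow> bool" where
  "phi_linear A \<longleftrightarrow> (\<forall>f g. A (f + g) = A f + A g) \<and> (\<forall>k f. A (k \<cdot>\<^sub>\<phi> f) = k \<cdot>\<^sub>\<phi> A f)"

lemma phi_linearD:
  assumes "phi_linear A"
  shows "A (f + g) = A f + A g" "A (k \<cdot>\<^sub>\<phi> f) = k \<cdot>\<^sub>\<phi> A f" "A 0 = 0" "A (f - g) = A f - A g"
    "A (sum h S) = (\<Sum>i\<in>S. A (h i))"
proof -
  show a: "A (f + g) = A f + A g" for f g using assms by (auto simp: phi_linear_def)
  show s: "A (k \<cdot>\<^sub>\<phi> f) = k \<cdot>\<^sub>\<phi> A f" for k f using assms by (auto simp: phi_linear_def)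
  show z: "A 0 = 0" using s[of 0 0] by simp
  show "A (f - g) = A f - A g" using a[of "f - g" g] by simp
  show "A (sum h S) = (\<Sum>i\<in>S. A (h i))"
    by (induction S rule: infinite_finite_induct) (auto simp: a z)
qed

lemma lin_ext_superset:
  assumes "finite A" "Poly_Mapping.keys f \<subseteq> A"
  shows "lin_ext g f = (\<Sum>(r, s)\<in>A. Poly_Mapping.lookup f (r, s) \<cdot>\<^sub>\<phi> g r s)"
  unfolding lin_ext_def
  by (rule sum.mono_neutral_left) (use assms in \<open>auto simp: in_keys_iff\<close>)

lemma lin_ext_linear: "phi_linear (lin_ext g)"
  unfolding phi_linear_def
proof (intro conjI allI)
  fix f h :: dualF
  let ?A = "Poly_Mapping.keys f \<union> Poly_Mapping.keys h"
  have "Poly_Mapping.keys (f + h) \<subseteq> ?A" by (rule keys_add)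
  then show "lin_ext g (f + h) = lin_ext g f + lin_ext g h"
    by (simp add: lin_ext_superset[of ?A] lookup_add lmul_add_left sum.distrib case_prod_unfold)
next
  fix k :: "complex fps" and f :: dualF
  have "Poly_Mapping.keys (k \<cdot>\<^sub>\<phi> f) \<subseteq> Poly_Mapping.keys f"
    by (auto simp: in_keys_iff lookup_lmul)
  then show "lin_ext g (k \<cdot>\<^sub>\<phi> f) = k \<cdot>\<^sub>\<phi> lin_ext g f"
    by (simp add: lin_ext_superset[of "Poly_Mapping.keys f"] lookup_lmul lmul_sum lmul_lmul
        case_prod_unfold)
qed

lemma lin_ext_mon [simp]: "lin_ext g (omon r s) = g r s"
  by (simp add: lin_ext_def omon_def)

lemma lin_ext_id: "lin_ext omon f = f"
  by (rule poly_mapping_eqI)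
     (auto simp: lin_ext_def lookup_sum lookup_lmul omon_def lookup_single when_def
       case_prod_unfold sum.delta in_keys_iff if_distrib cong: if_cong)

lemma phi_linear_lin_ext:
  assumes "phi_linear A"
  shows "A f = lin_ext (\<lambda>r s. A (omon r s)) f"
proof -
  have "A f = A (lin_ext omon f)" by (simp add: lin_ext_id)
  then show ?thesis
    by (simp add: lin_ext_def phi_linearD[OF assms] case_prod_unfold)
qed

lemma phi_linear_eqI:
  assumes "phi_linear A" "phi_linear B" "\<And>r s. A (omon r s) = B (omon r s)"
  shows "A f = B f"
  using phi_linear_lin_ext[OF assms(1), of f] phi_linear_lin_ext[OF assms(2), of f] assms(3) by simp

lemma phi_linear_comp: "phi_linear A \<Longrightarrow> phi_linear B \<Longrightarrow> phi_linear (\<lambda>f. A (B f))"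
  by (simp add: phi_linear_def)

lemma phi_linear_pow: "phi_linear A \<Longrightarrow> phi_linear (A ^^ n)"
  by (induction n) (auto simp: phi_linear_def)

lemma phi_linear_diff: "phi_linear A \<Longrightarrow> phi_linear B \<Longrightarrow> phi_linear (\<lambda>f. A f - B f)"
  by (simp add: phi_linear_def lmul_diff)

lemma phi_linear_lmul: "phi_linear A \<Longrightarrow> phi_linear (\<lambda>f. k \<cdot>\<^sub>\<phi> A f)"
  by (simp add: phi_linear_def lmul_add lmul_lmul mult.commute)

lemma phi_linear_add: "phi_linear A \<Longrightarrow> phi_linear B \<Longrightarrow> phi_linear (\<lambda>f. A f + B f)"
  by (simp add: phi_linear_def lmul_add)

lemma phi_linear_ops: "phi_linear abar1" "phi_linear abar2" "phi_linear da1" "phi_linear da2"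
    "phi_linear (lmul_a2 lam)"
  by (simp_all add: abar1_def abar2_def da1_def da2_def lmul_a2_def lin_ext_linear)

lemma ops_mon [simp]:
  "abar1 (omon r s) = omon (Suc r) s"
  "abar2 (omon r s) = omon r (Suc s)"
  "da1 (omon r s) = of_nat r \<cdot>\<^sub>c omon (r - 1) s"
  "da2 (omon r s) = of_nat s \<cdot>\<^sub>c omon r (s - 1)"
  "lmul_a2 lam (omon r s) = omon r (Suc s) - (of_nat r * of_real lam) \<cdot>\<^sub>c omon r s"
  by (simp_all add: abar1_def abar2_def da1_def da2_def lmul_a2_def)

lemma lmul_a2_abar1: "lmul_a2 lam (abar1 f) = abar1 (lmul_a2 lam f) - of_real lam \<cdot>\<^sub>c abar1 f"
proof (rule phi_linear_eqI[of "\<lambda>f. lmul_a2 lam (abar1 f)"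
      "\<lambda>f. abar1 (lmul_a2 lam f) - of_real lam \<cdot>\<^sub>c abar1 f"])
  show "phi_linear (\<lambda>f. lmul_a2 lam (abar1 f))"
    by (rule phi_linear_comp[OF phi_linear_ops(5,1)])
  show "phi_linear (\<lambda>f. abar1 (lmul_a2 lam f) - of_real lam \<cdot>\<^sub>c abar1 f)"
    by (rule phi_linear_diff[OF phi_linear_comp[OF phi_linear_ops(1,5)]
          phi_linear_lmul[OF phi_linear_ops(1)]])
next
  fix r s
  have e: "fps_const ((1 + of_nat r) * complex_of_real lam)
     = fps_const (of_nat r * of_real lam) + fps_const (of_real lam)"
    by (simp add: algebra_simps flip: fps_const_add)
  show "lmul_a2 lam (abar1 (omon r s))
      = abar1 (lmul_a2 lam (omon r s)) - of_real lam \<cdot>\<^sub>c abar1 (omon r s)"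
    by (simp add: phi_linearD[OF phi_linear_ops(1)] e lmul_add_left del: fps_const_add)
qed

lemma lmul_a2_abar1_pow:
  "lmul_a2 lam ((abar1 ^^ r) f)
     = (abar1 ^^ r) (lmul_a2 lam f) - (of_nat r * of_real lam) \<cdot>\<^sub>c (abar1 ^^ r) f"
proof (induction r)
  case (Suc r)
  have e: "fps_const ((1 + of_nat r) * complex_of_real lam)
     = fps_const (of_nat r * of_real lam) + fps_const (of_real lam)"
    by (simp add: algebra_simps flip: fps_const_add)
  show ?case
    by (simp add: lmul_a2_abar1 Suc phi_linearD[OF phi_linear_ops(1)] e lmul_add_left
        del: fps_const_add)
qed simp

abbreviation t_mult :: "real \<Rightarrow> dualF \<Rightarrow> dualF \<Rightarrow> dualF" where
  "t_mult lam f g \<equiv> f \<otimes>\<^bsub>U_t lam\<^esub> g"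

lemma t_mult_eq: "t_mult lam f g = lin_ext (\<lambda>r s. (abar1 ^^ r) ((lmul_a2 lam ^^ s) g)) f"
  by (simp add: U_t_def)

lemma t_mult_mon: "t_mult lam (omon r s) g = (abar1 ^^ r) ((lmul_a2 lam ^^ s) g)"
  by (simp add: t_mult_eq)

lemma t_mult_linear_left: "phi_linear (\<lambda>f. t_mult lam f g)"
  unfolding t_mult_eq by (rule lin_ext_linear)

lemma t_mult_linear_right: "phi_linear (\<lambda>g. t_mult lam f g)"
proof -
  have *: "phi_linear (\<lambda>g. (abar1 ^^ r) ((lmul_a2 lam ^^ s) g))" for r s
    by (rule phi_linear_comp[OF phi_linear_pow[OF phi_linear_ops(1)]
          phi_linear_pow[OF phi_linear_ops(5)]])
  show ?thesis
    unfolding phi_linear_def t_mult_eq lin_ext_def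
    by (auto simp: phi_linearD[OF *] lmul_add sum.distrib lmul_sum lmul_lmul case_prod_unfold
        mult.commute)
qed

lemma abar1_t_mult: "abar1 (t_mult lam f g) = t_mult lam (abar1 f) g"
  by (rule phi_linear_eqI[of "\<lambda>f. abar1 (t_mult lam f g)" "\<lambda>f. t_mult lam (abar1 f) g"])
     (simp_all add: t_mult_mon phi_linear_comp[OF phi_linear_ops(1) t_mult_linear_left]
       phi_linear_comp[OF t_mult_linear_left phi_linear_ops(1)])

lemma lmul_a2_t_mult: "lmul_a2 lam (t_mult lam f g) = t_mult lam (lmul_a2 lam f) g"
proof (rule phi_linear_eqI[of "\<lambda>f. lmul_a2 lam (t_mult lam f g)" "\<lambda>f. t_mult lam (lmul_a2 lam f) g"])
  show "phi_linear (\<lambda>f. lmul_a2 lam (t_mult lam f g))"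
    by (rule phi_linear_comp[OF phi_linear_ops(5) t_mult_linear_left])
  show "phi_linear (\<lambda>f. t_mult lam (lmul_a2 lam f) g)"
    by (rule phi_linear_comp[OF t_mult_linear_left phi_linear_ops(5)])
  show "lmul_a2 lam (t_mult lam (omon r s) g) = t_mult lam (lmul_a2 lam (omon r s)) g" for r s
    by (simp add: t_mult_mon lmul_a2_abar1_pow phi_linearD[OF t_mult_linear_left])
qed

lemma pow_t_mult:
  "(abar1 ^^ r) ((lmul_a2 lam ^^ s) (t_mult lam f g)) = t_mult lam ((abar1 ^^ r) ((lmul_a2 lam ^^ s) f)) g"
proof -
  have "(lmul_a2 lam ^^ s) (t_mult lam f g) = t_mult lam ((lmul_a2 lam ^^ s) f) g"
    by (induction s) (auto simp: lmul_a2_t_mult)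
  moreover have "(abar1 ^^ r) (t_mult lam f g) = t_mult lam ((abar1 ^^ r) f) g" for f
    by (induction r) (auto simp: abar1_t_mult)
  ultimately show ?thesis by simp
qed

lemma t_mult_assoc: "t_mult lam (t_mult lam f g) h = t_mult lam f (t_mult lam g h)"
  by (rule phi_linear_eqI[of "\<lambda>f. t_mult lam (t_mult lam f g) h" "\<lambda>f. t_mult lam f (t_mult lam g h)"])
     (simp_all add: t_mult_mon pow_t_mult t_mult_linear_left
       phi_linear_comp[OF t_mult_linear_left t_mult_linear_left])

lemma pow_mon: "(abar1 ^^ r) ((lmul_a2 lam ^^ s) (omon 0 0)) = omon r s"
proof -
  have "(lmul_a2 lam ^^ s) (omon 0 0) = omon 0 s" by (induction s) auto
  moreover have "(abar1 ^^ r) (omon 0 s) = omon r s" by (induction r) auto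
  ultimately show ?thesis by simp
qed

lemma t_mult_one: "t_mult lam (omon 0 0) f = f" "t_mult lam f (omon 0 0) = f"
  by (simp add: t_mult_mon) (simp add: t_mult_eq pow_mon lin_ext_id)

lemma U_t_carrier: "carrier (U_t lam) = {\<psi>. \<forall>k. \<exists>z. Poly_Mapping.lookup \<psi> k = fps_const z}"
  by (simp add: U_t_def)

lemma U_t_closed:
  "0 \<in> carrier (U_t lam)" "omon r s \<in> carrier (U_t lam)"
  "f \<in> carrier (U_t lam) \<Longrightarrow> g \<in> carrier (U_t lam) \<Longrightarrow> f + g \<in> carrier (U_t lam)"
  "f \<in> carrier (U_t lam) \<Longrightarrow> g \<in> carrier (U_t lam) \<Longrightarrow> f - g \<in> carrier (U_t lam)"
  "f \<in> carrier (U_t lam) \<Longrightarrow> z \<cdot>\<^sub>c f \<in> carrier (U_t lam)"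
proof -
  show "0 \<in> carrier (U_t lam)" by (auto simp: U_t_carrier intro: exI[of _ 0])
  show "omon r s \<in> carrier (U_t lam)"
    by (auto simp: U_t_carrier omon_def lookup_single when_def intro: exI[of _ 0] exI[of _ 1])
  show "f + g \<in> carrier (U_t lam)" if "f \<in> carrier (U_t lam)" "g \<in> carrier (U_t lam)"
    using that unfolding U_t_carrier by (simp add: lookup_add) (metis fps_const_add)
  show "f - g \<in> carrier (U_t lam)" if "f \<in> carrier (U_t lam)" "g \<in> carrier (U_t lam)"
    using that unfolding U_t_carrier by (simp add: lookup_minus) (metis fps_const_sub)
  show "z \<cdot>\<^sub>c f \<in> carrier (U_t lam)" if "f \<in> carrier (U_t lam)"
    using that unfolding U_t_carrier by (simp add: lookup_lmul) (metis fps_const_mult)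
qed

lemma U_t_sum:
  "(\<And>i. i \<in> A \<Longrightarrow> f i \<in> carrier (U_t lam)) \<Longrightarrow> sum f A \<in> carrier (U_t lam)"
  by (induction A rule: infinite_finite_induct) (auto intro: U_t_closed)

lemma U_t_lin_ext:
  assumes "f \<in> carrier (U_t lam)" "\<And>r s. g r s \<in> carrier (U_t lam)"
  shows "lin_ext g f \<in> carrier (U_t lam)"
  unfolding lin_ext_def
proof (rule U_t_sum, clarify)
  fix r s
  obtain z where "Poly_Mapping.lookup f (r, s) = fps_const z"
    using assms(1) by (auto simp: U_t_carrier)
  then show "Poly_Mapping.lookup f (r, s) \<cdot>\<^sub>\<phi> g r s \<in> carrier (U_t lam)"
    using U_t_closed(5)[OF assms(2)] by simp
qed

lemma U_t_ops:
  assumes "f \<in> carrier (U_t lam)"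
  shows "abar1 f \<in> carrier (U_t lam)" "abar2 f \<in> carrier (U_t lam)"
    "da1 f \<in> carrier (U_t lam)" "da2 f \<in> carrier (U_t lam)" "lmul_a2 lam' f \<in> carrier (U_t lam)"
  unfolding abar1_def abar2_def da1_def da2_def lmul_a2_def
  by (intro U_t_lin_ext assms U_t_closed)+

lemma U_t_ops_pow:
  assumes "f \<in> carrier (U_t lam)"
  shows "(abar1 ^^ n) f \<in> carrier (U_t lam)" "(lmul_a2 lam' ^^ n) f \<in> carrier (U_t lam)"
  by (induction n) (auto intro: U_t_ops assms)

lemma t_mult_closed:
  "f \<in> carrier (U_t lam) \<Longrightarrow> g \<in> carrier (U_t lam) \<Longrightarrow> t_mult lam f g \<in> carrier (U_t lam)"
  unfolding t_mult_eq by (intro U_t_lin_ext U_t_ops_pow)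

theorem ring_U_t: "ring (U_t lam)"
proof (rule ringI)
  have o: "\<one>\<^bsub>U_t lam\<^esub> = omon 0 0" and a: "(\<oplus>\<^bsub>U_t lam\<^esub>) = (+)" and z: "\<zero>\<^bsub>U_t lam\<^esub> = 0"
    by (simp_all add: U_t_def)
  show "abelian_group (U_t lam)"
  proof (rule abelian_groupI; unfold a z)
    fix x assume x: "x \<in> carrier (U_t lam)"
    show "\<exists>y\<in>carrier (U_t lam). y + x = 0"
      by (rule bexI[of _ "0 - x"]) (simp, intro U_t_closed x)
  qed (auto intro: U_t_closed simp: algebra_simps)
  show "monoid (U_t lam)"
    by (rule monoidI) (auto intro: U_t_closed t_mult_closed simp: o t_mult_assoc t_mult_one)
  fix x y w
  show "(x \<oplus>\<^bsub>U_t lam\<^esub> y) \<otimes>\<^bsub>U_t lam\<^esub> w = x \<otimes>\<^bsub>U_t lam\<^esub> w \<oplus>\<^bsub>U_t lam\<^esub> y \<otimes>\<^bsub>U_t lam\<^esub> w"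
    "w \<otimes>\<^bsub>U_t lam\<^esub> (x \<oplus>\<^bsub>U_t lam\<^esub> y) = w \<otimes>\<^bsub>U_t lam\<^esub> x \<oplus>\<^bsub>U_t lam\<^esub> w \<otimes>\<^bsub>U_t lam\<^esub> y"
    unfolding a
    by (rule phi_linearD(1)[OF t_mult_linear_left] phi_linearD(1)[OF t_mult_linear_right])+
qed

theorem U_t_ordered_monomials:
  "omon 1 0 [^]\<^bsub>U_t lam\<^esub> (r::nat) \<otimes>\<^bsub>U_t lam\<^esub> omon 0 1 [^]\<^bsub>U_t lam\<^esub> (s::nat) = omon r s"
proof -
  have o: "\<one>\<^bsub>U_t lam\<^esub> = omon 0 0" by (simp add: U_t_def)
  have "omon 1 0 [^]\<^bsub>U_t lam\<^esub> r = omon r 0"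
  proof (induction r)
    case (Suc r)
    have "(abar1 ^^ r) (omon (Suc 0) 0) = omon (Suc r) 0" by (induction r) auto
    with Suc show ?case by (simp add: nat_pow_Suc t_mult_mon)
  qed (simp add: nat_pow_0 o)
  moreover have "omon 0 1 [^]\<^bsub>U_t lam\<^esub> s = omon 0 s"
  proof (induction s)
    case (Suc s)
    have "(lmul_a2 lam ^^ s) (omon 0 (Suc 0)) = omon 0 (Suc s)" by (induction s) auto
    with Suc show ?case by (simp add: nat_pow_Suc t_mult_mon)
  qed (simp add: nat_pow_0 o)
  moreover have "(abar1 ^^ r) (omon 0 s) = omon r s" by (induction r) auto
  ultimately show ?thesis by (simp add: t_mult_mon)
qed

theorem U_t_relation:
  "omon 1 0 \<otimes>\<^bsub>U_t lam\<^esub> omon 0 1 - omon 0 1 \<otimes>\<^bsub>U_t lam\<^esub> omon 1 0 = of_real lam \<cdot>\<^sub>c omon 1 0"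
  by (simp add: t_mult_mon)

lemma exp_op_da2_finite: "finite {n. (z ^ n / fact n) \<cdot>\<^sub>c (da2 ^^ n) f \<noteq> 0}"
proof -
  have mon0: "(da2 ^^ n) (omon r s) = 0" if "s < n" for n r s
    using that
  proof (induction n arbitrary: s)
    case (Suc n)
    show ?case
    proof (cases s)
      case 0
      have "(da2 ^^ n) 0 = 0" by (rule phi_linearD(3)[OF phi_linear_pow[OF phi_linear_ops(4)]])
      with 0 show ?thesis by (simp add: funpow_swap1)
    next
      case (Suc s')
      then have "(da2 ^^ n) (omon r s') = 0" using Suc.prems by (intro Suc.IH) simp
      then show ?thesis
        by (simp add: Suc funpow_swap1 phi_linearD(2)[OF phi_linear_pow[OF phi_linear_ops(4)]])
    qed
  qed simp
  obtain N where N: "\<And>r s. (r, s) \<in> Poly_Mapping.keys f \<Longrightarrow> s < N"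
    using finite_nat_set_iff_bounded[of "snd ` Poly_Mapping.keys f"] by force
  have "(da2 ^^ n) f = 0" if "N \<le> n" for n
  proof -
    have "(da2 ^^ n) (omon r s) = 0" if "(r, s) \<in> Poly_Mapping.keys f" for r s
      using N[OF that] \<open>N \<le> n\<close> by (intro mon0) simp
    then show ?thesis
      by (subst phi_linear_lin_ext[OF phi_linear_pow[OF phi_linear_ops(4)]])
         (auto simp: lin_ext_def intro!: sum.neutral)
  qed
  then have "{n. (z ^ n / fact n) \<cdot>\<^sub>c (da2 ^^ n) f \<noteq> 0} \<subseteq> {..<N}"
    by (auto simp: not_le[symmetric])
  then show ?thesis by (rule finite_subset) simp
qed

lemma U_t_exp_op_da2:
  assumes "f \<in> carrier (U_t lam)"
  shows "exp_op z da2 f \<in> carrier (U_t lam)"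
proof -
  have "(da2 ^^ n) f \<in> carrier (U_t lam)" for n
    by (induction n) (auto intro: U_t_ops assms)
  then show ?thesis
    unfolding exp_op_def Sum_any.expand_set by (intro U_t_sum U_t_closed)
qed


subsection \<open>The pairing on monomials\<close>

lemma pd_zero [simp]: "pd1 0 = 0" "pd2 0 = 0"
  by (simp_all add: pd1_def pd2_def fun_eq_iff)

lemma pd_pow_zero [simp]: "(pd1 ^^ r) 0 = 0" "(pd2 ^^ s) 0 = 0"
   apply (induction r) apply (simp_all only: funpow_0 funpow.simps(2) o_apply pd_zero)
  apply (induction s) apply (simp_all only: funpow_0 funpow.simps(2) o_apply pd_zero)
  done

lemma pairing_superset:
  assumes "finite A" "Poly_Mapping.keys h \<subseteq> A" "finite B" "Poly_Mapping.keys f \<subseteq> B"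
  shows "pairing h f = (\<Sum>m\<in>A. \<Sum>(r, s)\<in>B. fact m * fps_nth (Poly_Mapping.lookup f (r, s)) m
     * (pd1 ^^ r) ((pd2 ^^ s) (Poly_Mapping.lookup h m)) 0 0)"
proof -
  have "(\<Sum>(r, s)\<in>Poly_Mapping.keys f. fact m * fps_nth (Poly_Mapping.lookup f (r, s)) m
     * (pd1 ^^ r) ((pd2 ^^ s) (Poly_Mapping.lookup h m)) 0 0)
    = (\<Sum>(r, s)\<in>B. fact m * fps_nth (Poly_Mapping.lookup f (r, s)) m
     * (pd1 ^^ r) ((pd2 ^^ s) (Poly_Mapping.lookup h m)) 0 0)" for m
    by (rule sum.mono_neutral_left) (use assms in \<open>auto simp: in_keys_iff\<close>)
  then show ?thesis
    unfolding pairing_def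
    by (simp only:) (rule sum.mono_neutral_left; use assms in \<open>auto simp: in_keys_iff\<close>)
qed

lemma has_vector_derivative_of_real_power:
  "((\<lambda>t. of_real t ^ n :: complex) has_vector_derivative of_nat n * of_real x ^ (n - 1)) (at x)"
proof -
  have "((\<lambda>t. of_real (t ^ n) :: complex) has_vector_derivative of_real (real n * x ^ (n - 1))) (at x)"
    by (intro has_vector_derivative_of_real)
       (auto simp: has_real_derivative_iff_has_vector_derivative[symmetric] intro!: derivative_eq_intros)
  then show ?thesis by simp
qed

lemma pd1_pow_monomial:
  "(pd1 ^^ r) (\<lambda>x y. k * of_real x ^ n * g y) 0 0 = (if r = n then fact n * k * g 0 else 0)"
proof (induction n arbitrary: r k)
  case 0
  have "pd1 (\<lambda>x y. k * g y) = 0" for k by (simp add: pd1_def fun_eq_iff)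
  then show ?case by (cases r) (auto simp: funpow_swap1)
next
  case (Suc n)
  have "pd1 (\<lambda>x y. k * of_real x ^ Suc n * g y) = (\<lambda>x y. (k * of_nat (Suc n)) * of_real x ^ n * g y)"
  proof (intro ext)
    fix x y
    have "((\<lambda>x. k * of_real x ^ Suc n * g y) has_vector_derivative
        k * (of_nat (Suc n) * of_real x ^ (Suc n - 1)) * g y) (at x)"
      by (intro has_vector_derivative_mult_left has_vector_derivative_mult_right
          has_vector_derivative_of_real_power)
    then show "pd1 (\<lambda>x y. k * of_real x ^ Suc n * g y) x y = (k * of_nat (Suc n)) * of_real x ^ n * g y"
      unfolding pd1_def by (subst vector_derivative_at) (assumption, simp only: diff_Suc_1 mult.assoc)
  qed
  note step = this
  show ?case
  proof (cases r)
    case 0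
    then show ?thesis by simp
  next
    case (Suc r')
    show ?thesis
      unfolding Suc funpow_Suc_right o_apply step Suc.IH by simp
  qed
qed

lemma pd2_pow_monomial:
  "(pd2 ^^ s) (\<lambda>x y. k * of_real x ^ n * of_real y ^ p)
     = (\<lambda>x y. (if s \<le> p then fact p / fact (p - s) * k else 0) * of_real x ^ n * of_real y ^ (p - s))"
proof (induction s)
  case (Suc s)
  have d: "pd2 (\<lambda>x y. k * of_real x ^ n * of_real y ^ q)
      = (\<lambda>x y. k * of_real x ^ n * (of_nat q * of_real y ^ (q - 1)))" for k q
    unfolding pd2_def
    by (intro ext vector_derivative_at has_vector_derivative_mult_right
        has_vector_derivative_of_real_power)
  show ?case
  proof (cases "Suc s \<le> p")
    case True
    then have "p - s = Suc (p - Suc s)" by simp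
    then have "(fact (p - s) :: complex) = of_nat (p - s) * fact (p - Suc s)"
      by (simp only: fact_Suc)
    moreover have "p - s \<noteq> 0" using True by simp
    ultimately have "fact p / fact (p - s) * of_nat (p - s) = (fact p / fact (p - Suc s) :: complex)"
      by (simp del: of_nat_diff)
    then have "fact p / fact (p - s) * k * X * (of_nat (p - s) * Y)
        = fact p / fact (p - Suc s) * k * X * Y" for X Y :: complex
      by (metis (no_types, opaque_lifting) mult.assoc mult.commute)
    moreover have "p - s - 1 = p - Suc s" by simp
    ultimately show ?thesis
      using True by (simp only: funpow.simps(2) o_apply Suc d Suc_leD if_True)
  next
    case False
    then show ?thesis
      by (simp only: funpow.simps(2) o_apply Suc d) (auto simp: fun_eq_iff not_less_eq_eq)
  qed
qed simp

theorem pairing_monomials: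
  "pairing (Poly_Mapping.single m (\<lambda>x y. of_real x ^ n * of_real y ^ p)) (fps_X ^ q \<cdot>\<^sub>\<phi> omon r s)
     = (if m = q \<and> n = r \<and> p = s then fact m * fact n * fact p else 0)"
proof -
  have D: "(pd1 ^^ r) ((pd2 ^^ s) (\<lambda>x y. of_real x ^ n * of_real y ^ p)) 0 0
      = (if n = r \<and> p = s then fact n * fact p else 0 :: complex)"
    using pd2_pow_monomial[of s 1 n p]
      pd1_pow_monomial[of r "if s \<le> p then fact p / fact (p - s) else 0" n "\<lambda>y. of_real y ^ (p - s)"]
    by (auto simp: power_0_left)
  show ?thesis
    by (subst pairing_superset[of "{m}" _ "{(r, s)}"])
       (auto simp: lookup_lmul omon_def D in_keys_iff lookup_single when_def split: if_splits)
qed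

theorem pairing_nondegenerate:
  assumes "\<And>h. h \<in> carrier (U_iso lam \<omega>) \<Longrightarrow> pairing h f = pairing h g"
  shows "f = g"
proof (rule poly_mapping_eqI, clarify, rule fps_ext)
  fix r s m
  let ?l = "\<lambda>x y. of_real x ^ r * of_real y ^ s :: complex"
  have D: "(pd1 ^^ r') ((pd2 ^^ s') ?l) 0 0
      = (if r = r' \<and> s = s' then fact r * fact s else 0 :: complex)" for r' s'
    using pd2_pow_monomial[of s' 1 r s]
      pd1_pow_monomial[of r' "if s' \<le> s then fact s / fact (s - s') else 0" r "\<lambda>y. of_real y ^ (s - s')"]
    by (auto simp: power_0_left)
  have P: "pairing (Poly_Mapping.single m ?l) f
      = fact m * fps_nth (Poly_Mapping.lookup f (r, s)) m * (fact r * fact s)" for f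
  proof -
    let ?B = "insert (r, s) (Poly_Mapping.keys f)"
    have "pairing (Poly_Mapping.single m ?l) f = (\<Sum>(r', s')\<in>?B.
        fact m * fps_nth (Poly_Mapping.lookup f (r', s')) m * (pd1 ^^ r') ((pd2 ^^ s') ?l) 0 0)"
      by (subst pairing_superset[of "{m}" _ ?B]) auto
    also have "\<dots> = (\<Sum>k\<in>?B. if k = (r, s)
        then fact m * fps_nth (Poly_Mapping.lookup f (r, s)) m * (fact r * fact s) else 0)"
      by (rule sum.cong) (auto simp: D split: if_splits)
    finally have "pairing (Poly_Mapping.single m ?l) f = (\<Sum>k\<in>?B. if k = (r, s)
        then fact m * fps_nth (Poly_Mapping.lookup f (r, s)) m * (fact r * fact s) else 0)" .
    then show ?thesis by (simp add: sum.delta)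
  qed
  have "(\<lambda>x y. of_real x ^ r) \<in> Lalg lam" for r
  proof (induction r)
    case (Suc r)
    then show ?case using Lalg.mult[OF Lalg.P1 Suc] by (simp add: times_fun_def)
  qed (use Lalg.const[of 1] in simp)
  moreover have "(\<lambda>x y. of_real y ^ r) \<in> Lalg lam" for r
  proof (induction r)
    case (Suc r)
    then show ?case using Lalg.mult[OF Lalg.P2 Suc] by (simp add: times_fun_def)
  qed (use Lalg.const[of 1] in simp)
  ultimately have "?l \<in> Lalg lam"
    using Lalg.mult[of "\<lambda>x y. of_real x ^ r" lam "\<lambda>x y. of_real y ^ s"] by (simp add: times_fun_def)
  then have "Poly_Mapping.single m ?l \<in> carrier (U_iso lam \<omega>)"
    by (simp add: U_iso_def H_carrier_single)
  from assms[OF this]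
  show "fps_nth (Poly_Mapping.lookup f (r, s)) m = fps_nth (Poly_Mapping.lookup g (r, s)) m"
    by (simp add: P)
qed

end

theory Submission
  imports Defs
begin

text \<open>
  Pairing \<open>l \<in> L\<close> with a normally ordered \<open>f\<close> reads off Taylor coefficients of \<open>l\<close> at the origin, so
  the transposes of \<open>\<partial>/\<partial>P\<^sub>i\<close> and of multiplication by \<open>P\<^sub>i\<close> are \<open>abar\<^sub>i\<close> and \<open>\<partial>/\<partial>a\<^sub>i\<close>, and that of
  multiplication by \<open>exp (- 2 lam P\<^sub>2)\<close> is the exponential of \<open>- 2 lam \<partial>/\<partial>a\<^sub>2\<close>. Since
  \<open>(J\<^sup>m l) J = J\<^sup>m\<^sup>+\<^sup>1 l + J\<^sup>m Jhat l\<close>, the left action of \<open>J\<close> is \<open>d/d\<phi>\<close> plus the transpose of \<open>Jhat\<close>, whereas the right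
  action of \<open>J\<close> is \<open>d/d\<phi>\<close> alone; its eigenvectors are the \<open>exp (c \<phi>) \<psi>\<close> by the uniqueness of
  solutions of \<open>f' = c f\<close> among formal power series.
\<close>

section \<open>Partial derivatives on \<open>Lalg\<close>\<close>

lemma pd_const [simp]: "pd1 (\<lambda>x y. k) = 0" "pd2 (\<lambda>x y. k) = 0"
  by (simp_all add: pd1_def pd2_def fun_eq_iff)

lemma pd_of_real [simp]:
  "pd1 (\<lambda>x y. of_real x) = 1" "pd2 (\<lambda>x y. of_real x) = 0"
  "pd1 (\<lambda>x y. of_real y) = 0" "pd2 (\<lambda>x y. of_real y) = 1"
proof -
  have "vector_derivative (of_real :: real \<Rightarrow> complex) (at x) = 1" for x
    using has_vector_derivative_of_real_power[of 1 x] by (auto intro: vector_derivative_at)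
  then show "pd1 (\<lambda>x y. of_real x) = 1" "pd2 (\<lambda>x y. of_real x) = 0"
    "pd1 (\<lambda>x y. of_real y) = 0" "pd2 (\<lambda>x y. of_real y) = 1"
    by (simp_all add: pd1_def pd2_def fun_eq_iff)
qed

text \<open>The rate \<open>a\<close> is arbitrary so as to cover both exponential generators, where
  it is \<open>lam\<close> or \<open>- lam\<close>, and the factor in \<open>Jhat\<close>, where it
  is \<open>- 2 * lam\<close>.\<close>

lemma pd_exp:
  "pd1 (\<lambda>x y. exp (of_real (a * y))) = 0"
  "pd2 (\<lambda>x y. exp (of_real (a * y))) = (\<lambda>x y. of_real a) * (\<lambda>x y. exp (of_real (a * y)))"
proof -
  show "pd1 (\<lambda>x y. exp (of_real (a * y))) = 0"
    by (simp add: pd1_def fun_eq_iff)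
  have "((\<lambda>t. exp (of_real (a * t)) :: complex) has_vector_derivative
      of_real a * exp (of_real (a * y))) (at y)" for y
  proof -
    have "((\<lambda>t. exp (a * t)) has_real_derivative a * exp (a * y)) (at y)"
      by (auto intro!: derivative_eq_intros)
    then have "((\<lambda>t. of_real (exp (a * t)) :: complex) has_vector_derivative
        of_real (a * exp (a * y))) (at y)"
      by (intro has_vector_derivative_of_real)
         (simp add: has_real_derivative_iff_has_vector_derivative)
    then show ?thesis
      unfolding exp_of_real of_real_mult[of a "exp (a * y)"] .
  qed
  then show "pd2 (\<lambda>x y. exp (of_real (a * y))) = (\<lambda>x y. of_real a) * (\<lambda>x y. exp (of_real (a * y)))"
    by (auto simp: pd2_def fun_eq_iff intro!: vector_derivative_at)
qed

lemma pd_const_mult: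
  assumes "f \<in> Lalg lam"
  shows "pd1 ((\<lambda>x y. k) * f) = (\<lambda>x y. k) * pd1 f" "pd2 ((\<lambda>x y. k) * f) = (\<lambda>x y. k) * pd2 f"
  by (simp_all only: pd_mult[OF Lalg.const assms] pd_const mult_zero_left add_0_right)

text \<open>Induction over the generators: both orders of differentiation agree on each of them, and
  the Leibniz rule applied twice to a product gives an expression symmetric in the two
  derivatives.\<close>

lemma pd1_pd2_commute: "f \<in> Lalg lam \<Longrightarrow> pd1 (pd2 f) = pd2 (pd1 f)"
proof (induction rule: Lalg.induct)
  case exp_pos
  show ?case
    by (simp only: pd_exp pd_const_mult[OF Lalg.exp_pos] pd_zero mult_zero_right)
next
  case exp_neg
  show ?case
    by (simp only: pd_exp pd_const_mult[OF Lalg.exp_neg] pd_zero mult_zero_right)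
next
  case (add f g)
  then show ?case by (simp add: pd_add[where lam = lam] Lalg_pd1 Lalg_pd2 del: plus_fun_apply)
next
  case (mult f g)
  then show ?case
    by (simp add: pd_mult[where lam = lam] pd_add[where lam = lam] Lalg.mult Lalg_pd1 Lalg_pd2 algebra_simps
        del: plus_fun_apply times_fun_apply)
qed (simp_all add: one_fun_def)

lemma Lalg_pd_pow:
  assumes "f \<in> Lalg lam"
  shows "(pd1 ^^ r) f \<in> Lalg lam" "(pd2 ^^ s) f \<in> Lalg lam"
proof -
  show "(pd1 ^^ r) f \<in> Lalg lam" by (induction r) (auto intro: Lalg_pd1 assms)
  show "(pd2 ^^ s) f \<in> Lalg lam" by (induction s) (auto intro: Lalg_pd2 assms)
qed

lemma pd_pow_add:
  assumes "f \<in> Lalg lam" "g \<in> Lalg lam"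
  shows "(pd1 ^^ r) (f + g) = (pd1 ^^ r) f + (pd1 ^^ r) g"
    "(pd2 ^^ s) (f + g) = (pd2 ^^ s) f + (pd2 ^^ s) g"
proof -
  show "(pd1 ^^ r) (f + g) = (pd1 ^^ r) f + (pd1 ^^ r) g"
    by (induction r) (simp_all add: pd_add[where lam = lam] Lalg_pd_pow assms del: plus_fun_apply)
  show "(pd2 ^^ s) (f + g) = (pd2 ^^ s) f + (pd2 ^^ s) g"
    by (induction s) (simp_all add: pd_add[where lam = lam] Lalg_pd_pow assms del: plus_fun_apply)
qed

lemma pd_pow_const_mult:
  assumes "f \<in> Lalg lam"
  shows "(pd1 ^^ r) ((\<lambda>x y. k) * f) = (\<lambda>x y. k) * (pd1 ^^ r) f"
    "(pd2 ^^ s) ((\<lambda>x y. k) * f) = (\<lambda>x y. k) * (pd2 ^^ s) f"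
proof -
  show "(pd1 ^^ r) ((\<lambda>x y. k) * f) = (\<lambda>x y. k) * (pd1 ^^ r) f"
    by (induction r) (simp_all add: pd_const_mult[where lam = lam] Lalg_pd_pow assms del: times_fun_apply)
  show "(pd2 ^^ s) ((\<lambda>x y. k) * f) = (\<lambda>x y. k) * (pd2 ^^ s) f"
    by (induction s) (simp_all add: pd_const_mult[where lam = lam] Lalg_pd_pow assms del: times_fun_apply)
qed

lemma pd2_pow_pd1:
  assumes "f \<in> Lalg lam"
  shows "(pd2 ^^ s) (pd1 f) = pd1 ((pd2 ^^ s) f)"
  by (induction s) (simp_all add: pd1_pd2_commute[where lam = lam] Lalg_pd_pow assms)

section \<open>Taylor functionals and transposition\<close>

text \<open>
  The value is a multiple of the monomial \<open>1\<close>, so that \<open>taylor l\<close> is an operator to which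
  \<open>phi_linear\<close> applies.
\<close>

definition taylor :: "fn \<Rightarrow> dualF \<Rightarrow> dualF" where
  "taylor l = lin_ext (\<lambda>r s. ((pd1 ^^ r) ((pd2 ^^ s) l) 0 0) \<cdot>\<^sub>c omon 0 0)"

lemma taylor_mon: "taylor l (omon r s) = ((pd1 ^^ r) ((pd2 ^^ s) l) 0 0) \<cdot>\<^sub>c omon 0 0"
  by (simp add: taylor_def)

lemma taylor_linear: "phi_linear (taylor l)"
  by (simp add: taylor_def lin_ext_linear)

lemma taylor_comp_linear: "phi_linear A \<Longrightarrow> phi_linear (\<lambda>f. taylor l (A f))"
  by (rule phi_linear_comp[OF taylor_linear])

lemma taylor_add:
  assumes "k \<in> Lalg lam" "l \<in> Lalg lam"
  shows "taylor (k + l) f = taylor k f + taylor l f"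
  by (rule phi_linear_eqI[OF taylor_linear phi_linear_add[OF taylor_linear taylor_linear]])
     (simp add: taylor_mon pd_pow_add[where lam = lam] Lalg_pd_pow assms
        flip: lmul_add_left)

lemma taylor_const_mult:
  assumes "l \<in> Lalg lam"
  shows "taylor ((\<lambda>x y. k) * l) f = k \<cdot>\<^sub>c taylor l f"
  by (rule phi_linear_eqI[OF taylor_linear phi_linear_lmul[OF taylor_linear]])
     (simp add: taylor_mon pd_pow_const_mult[where lam = lam] Lalg_pd_pow assms lmul_lmul)

text \<open>An additional derivative of \<open>l\<close> raises an exponent by one. In
  \<open>taylor\<close> the powers of \<open>pd2\<close> are innermost, so \<open>pd2\<close> merges
  with them directly, whereas \<open>pd1\<close> has to be commuted past them.\<close>

lemma taylor_pd:
  assumes "l \<in> Lalg lam"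
  shows "taylor (pd1 l) f = taylor l (abar1 f)" "taylor (pd2 l) f = taylor l (abar2 f)"
proof -
  show "taylor (pd1 l) f = taylor l (abar1 f)"
    by (rule phi_linear_eqI[OF taylor_linear taylor_comp_linear[OF phi_linear_ops(1)]])
       (simp add: taylor_mon pd2_pow_pd1[OF assms] funpow_swap1)
  show "taylor (pd2 l) f = taylor l (abar2 f)"
    by (rule phi_linear_eqI[OF taylor_linear taylor_comp_linear[OF phi_linear_ops(2)]])
       (simp add: taylor_mon funpow_swap1)
qed

text \<open>
  The derivatives of \<open>g\<close> being affine in \<open>g\<close> covers the coordinates and the exponentials at once.
\<close>

lemma taylor_mult:
  assumes g: "g \<in> Lalg lam" "pd1 g = (\<lambda>x y. a1) * g + (\<lambda>x y. b1)" "pd2 g = (\<lambda>x y. a2) * g + (\<lambda>x y. b2)"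
    and T: "phi_linear T" "T (omon 0 0) = g 0 0 \<cdot>\<^sub>c omon 0 0"
      "\<And>f. T (abar1 f) = abar1 (T f) + a1 \<cdot>\<^sub>c T f + b1 \<cdot>\<^sub>c f"
      "\<And>f. T (abar2 f) = abar2 (T f) + a2 \<cdot>\<^sub>c T f + b2 \<cdot>\<^sub>c f"
    and l: "l \<in> Lalg lam"
  shows "taylor (g * l) f = taylor l (T f)"
proof -
  note lin = phi_linearD[OF taylor_linear]
  have pd1: "pd1 (g * l) = g * pd1 l + ((\<lambda>x y. a1) * (g * l) + (\<lambda>x y. b1) * l)" if "l \<in> Lalg lam" for l
    by (simp add: pd_mult[OF g(1) that] g(2) algebra_simps)
  have pd2: "pd2 (g * l) = g * pd2 l + ((\<lambda>x y. a2) * (g * l) + (\<lambda>x y. b2) * l)" if "l \<in> Lalg lam" for l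
    by (simp add: pd_mult[OF g(1) that] g(3) algebra_simps)
  note cl = Lalg.add Lalg.mult Lalg.const Lalg_pd1 Lalg_pd2 g(1)
  \<comment> \<open>The function \<open>l\<close> must stay arbitrary: by the Leibniz rule the
    induction hypothesis is needed for the derivative of \<open>l\<close> as well as for
    \<open>l\<close>. The assumed commutation rules of \<open>T\<close> then reassemble the three
    summands.\<close>
  have "taylor (g * l) (omon r s) = taylor l (T (omon r s))" if "l \<in> Lalg lam" for r s l
    using that
  proof (induction r arbitrary: l)
    case 0
    then show ?case
    proof (induction s arbitrary: l)
      case 0
      then show ?case by (simp add: T(2) lin taylor_mon lmul_lmul)
    next
      case (Suc s)
      have "taylor (g * l) (omon 0 (Suc s)) = taylor (pd2 (g * l)) (omon 0 s)"
        using taylor_pd(2)[OF Lalg.mult[OF g(1) Suc.prems], of "omon 0 s"] by simp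
      also have "\<dots> = taylor (g * pd2 l) (omon 0 s) + a2 \<cdot>\<^sub>c taylor (g * l) (omon 0 s)
          + b2 \<cdot>\<^sub>c taylor l (omon 0 s)"
        using Suc.prems
        by (simp add: pd2 taylor_add[where lam = lam] taylor_const_mult[where lam = lam] cl)
      also have "\<dots> = taylor l (T (abar2 (omon 0 s)))"
        using Suc.prems
        by (simp add: Suc.IH Lalg_pd2 taylor_pd[where lam = lam] T(4) lin del: ops_mon)
      finally show ?case by (simp del: times_fun_apply)
    qed
  next
    case (Suc r)
    have "taylor (g * l) (omon (Suc r) s) = taylor (pd1 (g * l)) (omon r s)"
      using taylor_pd(1)[OF Lalg.mult[OF g(1) Suc.prems], of "omon r s"] by simp
    also have "\<dots> = taylor (g * pd1 l) (omon r s) + a1 \<cdot>\<^sub>c taylor (g * l) (omon r s)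
        + b1 \<cdot>\<^sub>c taylor l (omon r s)"
      using Suc.prems
      by (simp add: pd1 taylor_add[where lam = lam] taylor_const_mult[where lam = lam] cl)
    also have "\<dots> = taylor l (T (abar1 (omon r s)))"
      using Suc.prems
      by (simp add: Suc.IH Lalg_pd1 taylor_pd[where lam = lam] T(3) lin del: ops_mon)
    finally show ?case by (simp del: times_fun_apply)
  qed
  then show ?thesis
    by (rule phi_linear_eqI[OF taylor_linear taylor_comp_linear[OF T(1)]]) (use l in auto)
qed

section \<open>Weyl relations and the exponential of \<open>da2\<close>\<close>

lemma lmul_uminus [simp]: "(- k) \<cdot>\<^sub>\<phi> f = - (k \<cdot>\<^sub>\<phi> f)"
  by (rule poly_mapping_eqI) (simp add: lookup_lmul)

lemma phi_linear_uminus: "phi_linear A \<Longrightarrow> phi_linear (\<lambda>f. - A f)"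
  using phi_linear_diff[of "\<lambda>f. 0" A] by (simp add: phi_linear_def)

lemma phi_linear_id: "phi_linear (\<lambda>f. f)"
  by (simp add: phi_linear_def)

lemma lmul_of_nat_Suc: "of_nat (Suc n) \<cdot>\<^sub>c f = of_nat n \<cdot>\<^sub>c f + f"
proof -
  have "fps_const (of_nat (Suc n)) = fps_const (of_nat n) + (1 :: complex fps)"
    by (simp add: fps_const_add[symmetric] add.commute del: fps_const_add)
  then show ?thesis by (simp only: lmul_add_left lmul_simps)
qed

text \<open>All four operators merely shift and scale ordered monomials, so the noncommutativity of
  \<open>U_t\<close> does not enter and the canonical commutation relations hold as for commuting
  variables.\<close>

lemma weyl_relations:
  "da1 (abar1 f) = abar1 (da1 f) + f" "da1 (abar2 f) = abar2 (da1 f)"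
  "da2 (abar1 f) = abar1 (da2 f)" "da2 (abar2 f) = abar2 (da2 f) + f"
proof -
  note lin = phi_linear_ops
  note comp = phi_linear_comp[OF lin(3,1)] phi_linear_comp[OF lin(1,3)] phi_linear_comp[OF lin(3,2)]
    phi_linear_comp[OF lin(2,3)] phi_linear_comp[OF lin(4,1)] phi_linear_comp[OF lin(1,4)]
    phi_linear_comp[OF lin(4,2)] phi_linear_comp[OF lin(2,4)]
  note d = phi_linearD[OF lin(1)] phi_linearD[OF lin(2)] lmul_of_nat_Suc
  show "da1 (abar1 f) = abar1 (da1 f) + f"
  proof (rule phi_linear_eqI[OF comp(1) phi_linear_add[OF comp(2) phi_linear_id]])
    show "da1 (abar1 (omon r s)) = abar1 (da1 (omon r s)) + omon r s" for r s
      \<comment> \<open>For \<open>r = 0\<close> the truncated exponent \<open>r - 1\<close> is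
        harmless because its coefficient \<open>of_nat r\<close> vanishes.\<close>
      by (cases r) (simp_all add: d del: of_nat_Suc)
  qed
  show "da1 (abar2 f) = abar2 (da1 f)"
    by (rule phi_linear_eqI[OF comp(3,4)]) (simp add: d)
  show "da2 (abar1 f) = abar1 (da2 f)"
    by (rule phi_linear_eqI[OF comp(5,6)]) (simp add: d)
  show "da2 (abar2 f) = abar2 (da2 f) + f"
  proof (rule phi_linear_eqI[OF comp(7) phi_linear_add[OF comp(8) phi_linear_id]])
    show "da2 (abar2 (omon r s)) = abar2 (da2 (omon r s)) + omon r s" for r s
      by (cases s) (simp_all add: d del: of_nat_Suc)
  qed
qed

lemma da2_pow_abar1: "(da2 ^^ n) (abar1 f) = abar1 ((da2 ^^ n) f)"
  by (induction n) (simp_all add: weyl_relations)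

text \<open>Iterating \<open>[D, a] = 1\<close> gives \<open>[D^n, a] = n D^(n-1)\<close>; writing
  \<open>Suc n\<close> for n avoids a truncated predecessor.\<close>

lemma da2_pow_abar2:
  "(da2 ^^ Suc n) (abar2 f) = abar2 ((da2 ^^ Suc n) f) + of_nat (Suc n) \<cdot>\<^sub>c (da2 ^^ n) f"
proof (induction n)
  case (Suc n)
  have "(da2 ^^ Suc (Suc n)) (abar2 f) = da2 ((da2 ^^ Suc n) (abar2 f))" by simp
  also have "\<dots> = abar2 ((da2 ^^ Suc (Suc n)) f) + of_nat (Suc (Suc n)) \<cdot>\<^sub>c (da2 ^^ Suc n) f"
    unfolding Suc.IH phi_linearD[OF phi_linear_ops(4)] weyl_relations lmul_of_nat_Suc[of "Suc n"]
    by (simp add: add.commute add.left_commute)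
  finally show ?case .
qed (simp add: weyl_relations)

text \<open>Every sufficiently large bound is allowed, so that the series for several arguments can
  be cut at a common length.\<close>

lemma exp_op_da2_eq_sum:
  "\<exists>N. \<forall>M\<ge>N. exp_op z da2 f = (\<Sum>n<M. (z ^ n / fact n) \<cdot>\<^sub>c (da2 ^^ n) f)"
proof -
  let ?g = "\<lambda>n. (z ^ n / fact n) \<cdot>\<^sub>c (da2 ^^ n) f"
  obtain N where N: "\<forall>n\<in>{n. ?g n \<noteq> 0}. n < N"
    using exp_op_da2_finite finite_nat_set_iff_bounded by blast
  have "exp_op z da2 f = (\<Sum>n<M. ?g n)" if "N \<le> M" for M
    unfolding exp_op_def by (rule Sum_any.expand_superset) (use N that in force)+
  then show ?thesis by blast
qed

lemma exp_op_da2_linear: "phi_linear (exp_op z da2)"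
  unfolding phi_linear_def
proof (intro conjI allI)
  note d = phi_linearD[OF phi_linear_pow[OF phi_linear_ops(4)]]
  fix f g k
  obtain N1 where N1: "\<And>M. N1 \<le> M \<Longrightarrow> exp_op z da2 f = (\<Sum>n<M. (z ^ n / fact n) \<cdot>\<^sub>c (da2 ^^ n) f)"
    using exp_op_da2_eq_sum by blast
  obtain N2 where N2: "\<And>M. N2 \<le> M \<Longrightarrow> exp_op z da2 g = (\<Sum>n<M. (z ^ n / fact n) \<cdot>\<^sub>c (da2 ^^ n) g)"
    using exp_op_da2_eq_sum by blast
  obtain N3 where N3: "\<And>M. N3 \<le> M \<Longrightarrow>
      exp_op z da2 (f + g) = (\<Sum>n<M. (z ^ n / fact n) \<cdot>\<^sub>c (da2 ^^ n) (f + g))"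
    using exp_op_da2_eq_sum by blast
  obtain N4 where N4: "\<And>M. N4 \<le> M \<Longrightarrow>
      exp_op z da2 (k \<cdot>\<^sub>\<phi> f) = (\<Sum>n<M. (z ^ n / fact n) \<cdot>\<^sub>c (da2 ^^ n) (k \<cdot>\<^sub>\<phi> f))"
    using exp_op_da2_eq_sum by blast
  define M where "M = N1 + N2 + N3 + N4"
  have M: "N1 \<le> M" "N2 \<le> M" "N3 \<le> M" "N4 \<le> M" by (auto simp: M_def)
  show "exp_op z da2 (f + g) = exp_op z da2 f + exp_op z da2 g"
    by (simp add: N1[OF M(1)] N2[OF M(2)] N3[OF M(3)] d lmul_add sum.distrib)
  show "exp_op z da2 (k \<cdot>\<^sub>\<phi> f) = k \<cdot>\<^sub>\<phi> exp_op z da2 f"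
    by (simp add: N1[OF M(1)] N4[OF M(4)] d lmul_sum lmul_lmul mult.commute)
qed

lemma exp_op_da2_abar1: "exp_op z da2 (abar1 f) = abar1 (exp_op z da2 f)"
proof -
  obtain N1 where N1: "\<And>M. N1 \<le> M \<Longrightarrow> exp_op z da2 f = (\<Sum>n<M. (z ^ n / fact n) \<cdot>\<^sub>c (da2 ^^ n) f)"
    using exp_op_da2_eq_sum by blast
  obtain N2 where N2: "\<And>M. N2 \<le> M \<Longrightarrow>
      exp_op z da2 (abar1 f) = (\<Sum>n<M. (z ^ n / fact n) \<cdot>\<^sub>c (da2 ^^ n) (abar1 f))"
    using exp_op_da2_eq_sum by blast
  have M: "N1 \<le> N1 + N2" "N2 \<le> N1 + N2" by auto
  show ?thesis
    by (simp add: N1[OF M(1)] N2[OF M(2)] da2_pow_abar1 phi_linearD[OF phi_linear_ops(1)])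
qed

text \<open>The factor n in the commutator of \<open>da2 ^^ n\<close> with \<open>abar2\<close>
  turns z^n/n! into z times the preceding coefficient, so the commutator terms sum to z times the
  exponential series.\<close>

lemma exp_op_da2_abar2: "exp_op z da2 (abar2 f) = abar2 (exp_op z da2 f) + z \<cdot>\<^sub>c exp_op z da2 f"
proof -
  note d = phi_linearD[OF phi_linear_ops(2)]
  obtain N1 where N1: "\<And>M. N1 \<le> M \<Longrightarrow> exp_op z da2 f = (\<Sum>n<M. (z ^ n / fact n) \<cdot>\<^sub>c (da2 ^^ n) f)"
    using exp_op_da2_eq_sum by blast
  obtain N2 where N2: "\<And>M. N2 \<le> M \<Longrightarrow>
      exp_op z da2 (abar2 f) = (\<Sum>n<M. (z ^ n / fact n) \<cdot>\<^sub>c (da2 ^^ n) (abar2 f))"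
    using exp_op_da2_eq_sum by blast
  define M where "M = N1 + N2"
  \<comment> \<open>Splitting off the term of index 0 shortens the commutator sum by one, so the
    series for \<open>f\<close> is needed at both lengths \<open>M\<close> and
    \<open>Suc M\<close>.\<close>
  have M: "N1 \<le> M" "N1 \<le> Suc M" "N2 \<le> Suc M" by (auto simp: M_def)
  have s: "(z ^ Suc n / fact (Suc n)) \<cdot>\<^sub>c (da2 ^^ Suc n) (abar2 f)
      = abar2 ((z ^ Suc n / fact (Suc n)) \<cdot>\<^sub>c (da2 ^^ Suc n) f)
        + z \<cdot>\<^sub>c (z ^ n / fact n) \<cdot>\<^sub>c (da2 ^^ n) f" for n
  proof -
    have "(z ^ Suc n / fact (Suc n)) * of_nat (Suc n) = z * (z ^ n / fact n)"
      by (simp add: field_simps del: of_nat_Suc)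
    then show ?thesis
      unfolding da2_pow_abar2 d lmul_add lmul_lmul fps_const_mult by simp
  qed
  have "exp_op z da2 (abar2 f) = abar2 f + (\<Sum>n<M. (z ^ Suc n / fact (Suc n)) \<cdot>\<^sub>c (da2 ^^ Suc n) (abar2 f))"
    unfolding N2[OF M(3)] sum.lessThan_Suc_shift by simp
  also have "\<dots> = abar2 f + (\<Sum>n<M. abar2 ((z ^ Suc n / fact (Suc n)) \<cdot>\<^sub>c (da2 ^^ Suc n) f))
        + (\<Sum>n<M. z \<cdot>\<^sub>c (z ^ n / fact n) \<cdot>\<^sub>c (da2 ^^ n) f)"
    unfolding s sum.distrib by (simp only: add.assoc)
  also have "abar2 f + (\<Sum>n<M. abar2 ((z ^ Suc n / fact (Suc n)) \<cdot>\<^sub>c (da2 ^^ Suc n) f))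
      = abar2 (\<Sum>n<Suc M. (z ^ n / fact n) \<cdot>\<^sub>c (da2 ^^ n) f)"
    unfolding sum.lessThan_Suc_shift d by simp
  also have "(\<Sum>n<M. z \<cdot>\<^sub>c (z ^ n / fact n) \<cdot>\<^sub>c (da2 ^^ n) f) = z \<cdot>\<^sub>c exp_op z da2 f"
    unfolding N1[OF M(1)] lmul_sum ..
  finally show ?thesis unfolding N1[OF M(2), symmetric] .
qed

lemma exp_op_da2_one: "exp_op z da2 (omon 0 0) = omon 0 0"
proof -
  obtain N where N: "\<And>M. N \<le> M \<Longrightarrow>
      exp_op z da2 (omon 0 0) = (\<Sum>n<M. (z ^ n / fact n) \<cdot>\<^sub>c (da2 ^^ n) (omon 0 0))"
    using exp_op_da2_eq_sum by blast
  have "(da2 ^^ Suc n) (omon 0 0) = 0" for n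
    by (simp only: funpow_Suc_right o_apply ops_mon)
       (simp add: phi_linearD[OF phi_linear_pow[OF phi_linear_ops(4)]])
  then have "(\<Sum>n<Suc N. (z ^ n / fact n) \<cdot>\<^sub>c (da2 ^^ n) (omon 0 0)) = omon 0 0"
    unfolding sum.lessThan_Suc_shift by (simp del: funpow.simps(2))
  with N[of "Suc N"] show ?thesis by simp
qed

section \<open>Transposes of the multiplications and of \<open>Jhat\<close>\<close>

lemma taylor_coord:
  assumes "l \<in> Lalg lam"
  shows "taylor ((\<lambda>x y. of_real x) * l) f = taylor l (da1 f)"
    "taylor ((\<lambda>x y. of_real y) * l) f = taylor l (da2 f)"
proof -
  show "taylor ((\<lambda>x y. of_real x) * l) f = taylor l (da1 f)"
    \<comment> \<open>A coordinate has constant derivatives: \<open>a1\<close> and \<open>a2\<close>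
      vanish, \<open>b1\<close> and \<open>b2\<close> are the two partial derivatives, and the
      conditions on \<open>T\<close> become the Weyl relations.\<close>
    by (rule taylor_mult[OF Lalg.P1[of lam], where ?a1.0 = 0 and ?b1.0 = 1 and ?a2.0 = 0 and ?b2.0 = 0])
       (simp_all add: assms phi_linear_ops weyl_relations, simp_all add: fun_eq_iff)
  show "taylor ((\<lambda>x y. of_real y) * l) f = taylor l (da2 f)"
    by (rule taylor_mult[OF Lalg.P2[of lam], where ?a1.0 = 0 and ?b1.0 = 0 and ?a2.0 = 0 and ?b2.0 = 1])
       (simp_all add: assms phi_linear_ops weyl_relations, simp_all add: fun_eq_iff)
qed

lemma exp_m2_Lalg: "(\<lambda>x y. exp (of_real (- 2 * lam * y))) \<in> Lalg lam"
proof -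
  have "(\<lambda>x y. exp (of_real (- 2 * lam * y)) :: complex)
      = (\<lambda>x y. exp (of_real (- lam * y))) * (\<lambda>x y. exp (of_real (- lam * y)))"
    by (simp add: fun_eq_iff mult_exp_exp ac_simps)
  also have "\<dots> \<in> Lalg lam" by (intro Lalg.mult Lalg.exp_neg)
  finally show ?thesis .
qed

text \<open>The exponential is an eigenvector of \<open>pd2\<close> with eigenvalue
  \<open>- 2 * lam\<close> and is annihilated by \<open>pd1\<close>; \<open>exp_op\<close> obeys the
  matching commutation rules and fixes the monomial 1, as the exponential equals 1 at the
  origin.\<close>

lemma taylor_exp:
  assumes "l \<in> Lalg lam"
  shows "taylor ((\<lambda>x y. exp (of_real (- 2 * lam * y))) * l) f
    = taylor l (exp_op (- 2 * of_real lam) da2 f)"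
proof (rule taylor_mult[OF exp_m2_Lalg])
  let ?E = "\<lambda>x y. exp (of_real (- 2 * lam * y)) :: complex"
  show "pd1 ?E = (\<lambda>x y. 0) * ?E + (\<lambda>x y. 0)"
    unfolding pd_exp by (simp add: fun_eq_iff)
  show "pd2 ?E = (\<lambda>x y. - 2 * of_real lam) * ?E + (\<lambda>x y. 0)"
    unfolding pd_exp by (simp add: fun_eq_iff)
qed (simp_all add: exp_op_da2_linear exp_op_da2_abar1 exp_op_da2_abar2 exp_op_da2_one assms)

text \<open>The transpose of \<open>Jhat\<close> with respect to the pairing.\<close>

definition Jdual :: "real \<Rightarrow> real \<Rightarrow> dualF \<Rightarrow> dualF" where
  "Jdual lam \<omega> f =
     - abar1 ((1 / (2 * of_real lam)) \<cdot>\<^sub>c (f - exp_op (- 2 * of_real lam) da2 f))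
     + of_real \<omega> \<cdot>\<^sub>c abar2 (da1 f)
     - (of_real lam / 2 * of_real \<omega>) \<cdot>\<^sub>c abar1 ((da1 ^^ 2) f)"

lemma Jdual_linear: "phi_linear (Jdual lam \<omega>)"
  unfolding Jdual_def
  by (intro phi_linear_add phi_linear_diff phi_linear_uminus phi_linear_lmul phi_linear_id
      phi_linear_comp[OF phi_linear_ops(1)] phi_linear_comp[OF phi_linear_ops(2)]
      phi_linear_ops phi_linear_pow exp_op_da2_linear)

text \<open>\<open>Jhat\<close> differentiates before it multiplies. Transposition reverses this
  order, which puts each of \<open>abar1\<close> and \<open>abar2\<close> to the left of the
  derivatives and of the exponential in \<open>Jdual\<close>.\<close>

lemma taylor_Jhat:
  assumes l: "l \<in> Lalg lam"
  shows "taylor (Jhat lam \<omega> l) f = taylor l (Jdual lam \<omega> f)"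
proof -
  let ?E = "\<lambda>x y. exp (of_real (- 2 * lam * y)) :: complex"
  let ?X = "\<lambda>x y. of_real x :: complex"
  let ?K = "\<lambda>k x y. k :: complex"
  let ?a = "1 / (2 * of_real lam) :: complex"
  let ?b = "of_real lam / 2 * of_real \<omega> :: complex"
  \<comment> \<open>The bracket is multiplied out so that every summand is a scalar times a
    composite of operators with known transposes.\<close>
  have e: "Jhat lam \<omega> l = ?K (- ?a) * pd1 l + ?K ?a * (?E * pd1 l)
      + ?K (- ?b) * (?X * (?X * pd1 l)) + ?K (of_real \<omega>) * (?X * pd2 l)"
  proof (intro ext)
    fix x y
    have E: "?E x y = of_real (exp (- 2 * lam * y))"
      by (rule exp_of_real)
    show "Jhat lam \<omega> l x y = (?K (- ?a) * pd1 l + ?K ?a * (?E * pd1 l)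
      + ?K (- ?b) * (?X * (?X * pd1 l)) + ?K (of_real \<omega>) * (?X * pd2 l)) x y"
      unfolding Jhat_def plus_fun_apply times_fun_apply E
      by (simp add: power2_eq_square algebra_simps diff_divide_distrib)
  qed
  note cl = Lalg.add Lalg.mult Lalg.const Lalg.P1 exp_m2_Lalg Lalg_pd1 Lalg_pd2 l
  have "taylor (Jhat lam \<omega> l) f = (- ?a) \<cdot>\<^sub>c taylor l (abar1 f)
      + ?a \<cdot>\<^sub>c taylor l (abar1 (exp_op (- 2 * of_real lam) da2 f))
      + (- ?b) \<cdot>\<^sub>c taylor l (abar1 (da1 (da1 f))) + of_real \<omega> \<cdot>\<^sub>c taylor l (abar2 (da1 f))"
    unfolding e
    by (simp only: taylor_add[where lam = lam] taylor_const_mult[where lam = lam]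
        taylor_coord[where lam = lam] taylor_exp taylor_pd[where lam = lam] cl)
  moreover have "taylor l (- h) = - taylor l h" for h
    using phi_linearD(4)[OF taylor_linear, of l 0 h] by (simp add: phi_linearD[OF taylor_linear])
  ultimately show ?thesis
    by (simp add: Jdual_def phi_linearD[OF taylor_linear] phi_linearD[OF phi_linear_ops(1)]
        lmul_diff numeral_2_eq_2 flip: fps_const_neg)
qed

section \<open>The pairing and the regular actions of the generators\<close>

text \<open>By linearity over power series, the coefficient of the monomial 1 in
  \<open>taylor l f\<close> is a series in \<phi>; pairing with \<open>J^m l\<close> reads off its
  m-th coefficient times m!. A set \<open>A\<close> larger than the support lets different elements
  of H be compared termwise.\<close>

lemma pairing_taylor:
  assumes "finite A" "Poly_Mapping.keys h \<subseteq> A"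
  shows "pairing h f = (\<Sum>m\<in>A. fact m *
    fps_nth (Poly_Mapping.lookup (taylor (Poly_Mapping.lookup h m) f) (0, 0)) m)"
  unfolding pairing_superset[OF assms finite_keys order_refl]
  by (rule sum.cong)
     (simp_all add: taylor_def lin_ext_def case_prod_unfold lookup_sum lookup_lmul omon_def
       fps_sum_nth sum_distrib_left mult.assoc)

definition dphi :: "dualF \<Rightarrow> dualF" where
  "dphi f = Poly_Mapping.map fps_deriv f"

lemma lookup_dphi: "Poly_Mapping.lookup (dphi f) k = fps_deriv (Poly_Mapping.lookup f k)"
  by (simp add: dphi_def Poly_Mapping.map.rep_eq when_def)

text \<open>The Taylor values of \<open>l\<close> are constant in \<phi>, so the derivative passes
  through them to the coefficients of \<open>f\<close>.\<close>

lemma lookup_taylor_dphi: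
  "Poly_Mapping.lookup (taylor l (dphi f)) (0, 0) = fps_deriv (Poly_Mapping.lookup (taylor l f) (0, 0))"
proof -
  \<comment> \<open>The support can shrink, since constant coefficients are annihilated; both sums
    are therefore taken over the support of \<open>f\<close>.\<close>
  have "Poly_Mapping.keys (dphi f) \<subseteq> Poly_Mapping.keys f"
    by (auto simp: in_keys_iff lookup_dphi)
  then have "taylor l (dphi f) = (\<Sum>(r, s)\<in>Poly_Mapping.keys f.
      Poly_Mapping.lookup (dphi f) (r, s) \<cdot>\<^sub>\<phi> ((pd1 ^^ r) ((pd2 ^^ s) l) 0 0) \<cdot>\<^sub>c omon 0 0)"
    unfolding taylor_def by (rule lin_ext_superset[OF finite_keys])
  then show ?thesis
    by (simp add: taylor_def lin_ext_def case_prod_unfold lookup_sum lookup_lmul omon_def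
        lookup_dphi fps_deriv_sum)
qed

lemma pairing_add_right: "pairing h (f + g) = pairing h f + pairing h g"
  by (simp add: pairing_taylor[OF finite_keys order_refl] phi_linearD[OF taylor_linear] lookup_add
      distrib_left sum.distrib)

text \<open>Nondegeneracy of the pairing makes the description in \<open>left_act\<close> unique, so
  a candidate only has to satisfy the transposed identity.\<close>

lemma left_act_eqI:
  assumes "\<And>h'. h' \<in> H_carrier lam \<Longrightarrow> pairing h' g = pairing (H_mult lam \<omega> h' h) f"
  shows "left_act lam \<omega> h f = g"
  unfolding left_act_def
proof (rule the_equality)
  show "\<forall>h'\<in>carrier (U_iso lam \<omega>). pairing h' g = pairing (H_mult lam \<omega> h' h) f"
    using assms by (simp add: U_iso_def)
  show "g' = g" if "\<forall>h'\<in>carrier (U_iso lam \<omega>). pairing h' g' = pairing (H_mult lam \<omega> h' h) f" for g'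
    by (rule pairing_nondegenerate[of lam \<omega>]) (use that assms in \<open>simp add: U_iso_def\<close>)
qed

lemma right_act_eqI:
  assumes "\<And>h'. h' \<in> H_carrier lam \<Longrightarrow> pairing h' g = pairing (H_mult lam \<omega> h h') f"
  shows "right_act lam \<omega> f h = g"
  unfolding right_act_def
proof (rule the_equality)
  show "\<forall>h'\<in>carrier (U_iso lam \<omega>). pairing h' g = pairing (H_mult lam \<omega> h h') f"
    using assms by (simp add: U_iso_def)
  show "g' = g" if "\<forall>h'\<in>carrier (U_iso lam \<omega>). pairing h' g' = pairing (H_mult lam \<omega> h h') f" for g'
    by (rule pairing_nondegenerate[of lam \<omega>]) (use that assms in \<open>simp add: U_iso_def\<close>)
qed

text \<open>The factor \<open>m!\<close> in the pairing turns the shift \<open>J\<^sup>m \<mapsto> J\<^sup>m\<^sup>+\<^sup>1\<close> into \<open>d/d\<phi>\<close>.\<close>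

lemma pairing_shift:
  assumes "Poly_Mapping.lookup g 0 = 0"
    "\<And>m. Poly_Mapping.lookup g (Suc m) = Poly_Mapping.lookup h m"
  shows "pairing g f = pairing h (dphi f)"
proof -
  let ?A = "Poly_Mapping.keys h"
  have "Poly_Mapping.keys g \<subseteq> Suc ` ?A"
  proof
    fix m assume "m \<in> Poly_Mapping.keys g"
    then show "m \<in> Suc ` ?A" using assms by (cases m) (auto simp: in_keys_iff)
  qed
  then show ?thesis
    by (simp add: pairing_taylor[of "Suc ` ?A" g] pairing_taylor[of ?A h] sum.reindex assms(2)
        lookup_taylor_dphi mult.assoc mult.left_commute)
qed

text \<open>Multiplying \<open>J^n l\<close> by J from the left only raises the power of J; no
  commutator arises.\<close>

lemma right_act_J: "right_act lam \<omega> f gen_J = dphi f"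
proof (rule right_act_eqI)
  fix h'
  have "H_mult lam \<omega> gen_J h' = (\<Sum>n\<in>Poly_Mapping.keys h'.
      Poly_Mapping.single (Suc n) (Poly_Mapping.lookup h' n))"
    unfolding H_mult_superset[OF finite_keys order_refl, of _ _ _ h'] gen_J_def rmulJ_pow_one rmulL_single
    by simp
  then have "Poly_Mapping.lookup (H_mult lam \<omega> gen_J h') 0 = 0"
    "Poly_Mapping.lookup (H_mult lam \<omega> gen_J h') (Suc m) = Poly_Mapping.lookup h' m" for m
    by (auto simp: lookup_sum lookup_single when_def in_keys_iff)
  then show "pairing h' (dphi f) = pairing (H_mult lam \<omega> gen_J h') f"
    using pairing_shift by metis
qed

lemma left_act_J: "left_act lam \<omega> gen_J f = dphi f + Jdual lam \<omega> f"
proof (rule left_act_eqI)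
  fix h' assume h': "h' \<in> H_carrier lam"
  then have L: "Poly_Mapping.lookup h' m \<in> Lalg lam" for m by (simp add: H_carrier_def)
  \<comment> \<open>The product of \<open>h'\<close> with J splits into the shifted part
    \<open>g\<close> and the commutator part \<open>k\<close>.\<close>
  define g where "g = (\<Sum>m\<in>Poly_Mapping.keys h'. Poly_Mapping.single (Suc m) (Poly_Mapping.lookup h' m))"
  define k where "k = Poly_Mapping.map (Jhat lam \<omega>) h'"
  \<comment> \<open>\<open>Poly_Mapping.map\<close> acts on nonzero values only, which is consistent
    here because \<open>Jhat\<close> sends 0 to 0.\<close>
  have k: "Poly_Mapping.lookup k m = Jhat lam \<omega> (Poly_Mapping.lookup h' m)" for m
    by (simp add: k_def Poly_Mapping.map.rep_eq when_def)
  have g: "Poly_Mapping.lookup g 0 = 0" "Poly_Mapping.lookup g (Suc m) = Poly_Mapping.lookup h' m" for m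
    by (auto simp: g_def lookup_sum lookup_single when_def in_keys_iff)
  have gl: "Poly_Mapping.lookup g m \<in> Lalg lam" for m
    using g L by (cases m) (auto simp: Lalg_zero)
  have gk: "H_mult lam \<omega> h' gen_J = g + k"
    by (rule poly_mapping_eqI)
       (simp add: gen_J_def H_mult_single lookup_rmulJ lookup_add g k split: nat.split)
  define A where "A = Poly_Mapping.keys g \<union> Poly_Mapping.keys k \<union> Poly_Mapping.keys h'"
  have A: "finite A" "Poly_Mapping.keys g \<subseteq> A" "Poly_Mapping.keys k \<subseteq> A" "Poly_Mapping.keys h' \<subseteq> A"
    "Poly_Mapping.keys (g + k) \<subseteq> A"
    using keys_add[of g k] by (auto simp: A_def)
  have kl: "Poly_Mapping.lookup k m \<in> Lalg lam" for m
    unfolding k by (rule Jhat_Lalg[OF L])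
  have "pairing (g + k) f = pairing g f + pairing k f"
    unfolding pairing_taylor[OF A(1,5)] pairing_taylor[OF A(1,2)] pairing_taylor[OF A(1,3)]
      lookup_add taylor_add[OF gl kl]
    by (simp add: distrib_left sum.distrib)
  moreover have "pairing g f = pairing h' (dphi f)" by (rule pairing_shift[OF g])
  moreover have "pairing k f = pairing h' (Jdual lam \<omega> f)"
    unfolding pairing_taylor[OF A(1,3)] pairing_taylor[OF A(1,4)] k taylor_Jhat[OF L] ..
  ultimately show "pairing h' (dphi f + Jdual lam \<omega> f) = pairing (H_mult lam \<omega> h' gen_J) f"
    by (simp add: gk pairing_add_right)
qed

text \<open>Right multiplication by \<open>p\<close> leaves each power of J in place, so the action
  is the transpose of multiplication by \<open>p\<close> alone.\<close>

lemma left_act_incL: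
  assumes "\<And>l. l \<in> Lalg lam \<Longrightarrow> taylor (p * l) f = taylor l g"
  shows "left_act lam \<omega> (incL p) f = g"
proof (rule left_act_eqI)
  fix h' assume h': "h' \<in> H_carrier lam"
  have "Poly_Mapping.keys (rmulL h' p) \<subseteq> Poly_Mapping.keys h'"
    by (auto simp: in_keys_iff lookup_rmulL)
  moreover have "H_mult lam \<omega> h' (incL p) = rmulL h' p"
    by (simp add: incL_def H_mult_single)
  ultimately show "pairing h' g = pairing (H_mult lam \<omega> h' (incL p)) f"
    using h' by (simp add: pairing_taylor[of "Poly_Mapping.keys h'"] lookup_rmulL H_carrier_def
        mult.commute[of _ p] assms)
qed

lemma left_act_P: "left_act lam \<omega> gen_P1 f = da1 f" "left_act lam \<omega> gen_P2 f = da2 f"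
  unfolding gen_P1_def gen_P2_def by (rule left_act_incL, rule taylor_coord, assumption)+

section \<open>The carrier space and the action on it\<close>

lemma exp_emb_inverse: "exp_emb (- c) (exp_emb c f) = f"
  unfolding exp_emb_def lmul_lmul by (simp flip: fps_exp_add_mult)

text \<open>The coefficients of \<open>f\<close> are constant in \<phi>, so only the exponential is
  differentiated.\<close>

lemma dphi_exp_emb:
  assumes "f \<in> carrier (U_t lam)"
  shows "dphi (exp_emb c f) = c \<cdot>\<^sub>c exp_emb c f"
proof (rule poly_mapping_eqI)
  fix k
  obtain z where "Poly_Mapping.lookup f k = fps_const z" using assms unfolding U_t_carrier by blast
  then show "Poly_Mapping.lookup (dphi (exp_emb c f)) k = Poly_Mapping.lookup (c \<cdot>\<^sub>c exp_emb c f) k"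
    by (simp add: lookup_dphi exp_emb_def lookup_lmul mult.assoc)
qed

lemma exp_emb_bij: "bij_betw (exp_emb c) (carrier (U_t lam)) (local_rep_space lam \<omega> c)"
proof (rule bij_betw_byWitness[where f' = "exp_emb (- c)"])
  show "\<forall>\<psi>\<in>carrier (U_t lam). exp_emb (- c) (exp_emb c \<psi>) = \<psi>"
    by (simp add: exp_emb_inverse)
  show "\<forall>f\<in>local_rep_space lam \<omega> c. exp_emb c (exp_emb (- c) f) = f"
    using exp_emb_inverse[of "- c"] by simp
  show "exp_emb c ` carrier (U_t lam) \<subseteq> local_rep_space lam \<omega> c"
    by (auto simp: local_rep_space_def right_act_J dphi_exp_emb)
  show "exp_emb (- c) ` local_rep_space lam \<omega> c \<subseteq> carrier (U_t lam)"
  proof (clarsimp simp: local_rep_space_def right_act_J U_t_carrier)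
    fix f r s assume "dphi f = c \<cdot>\<^sub>c f"
    then have "fps_deriv (Poly_Mapping.lookup f (r, s)) = fps_const c * Poly_Mapping.lookup f (r, s)"
      by (metis lookup_dphi lookup_lmul)
    then obtain z where "Poly_Mapping.lookup f (r, s) = fps_const z * fps_exp c"
      unfolding fps_exp_unique_ODE by metis
    \<comment> \<open>The exponents cancel, leaving the constant \<open>z\<close> as the
      coefficient.\<close>
    moreover have "fps_exp (- c) * (fps_const z * fps_exp c) = fps_const z * fps_exp (- c + c)"
      by (simp only: fps_exp_add_mult mult.assoc mult.left_commute)
    ultimately have "Poly_Mapping.lookup (exp_emb (- c) f) (r, s) = fps_const z"
      by (simp add: exp_emb_def lookup_lmul)
    then show "\<exists>z. Poly_Mapping.lookup (exp_emb (- c) f) (r, s) = fps_const z" ..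
  qed
qed

theorem mainTheorem5:
  fixes \<omega> lam :: real and c :: complex
  assumes "lam \<noteq> 0"
  shows "bij_betw (exp_emb c) (carrier (U_t lam)) (local_rep_space lam \<omega> c)
    \<and> (\<forall>\<psi>\<in>carrier (U_t lam).
        local_rep_act lam \<omega> gen_J (exp_emb c \<psi>) =
          exp_emb c
            (c \<cdot>\<^sub>c \<psi>
             - abar1 ((1 / (2 * of_real lam)) \<cdot>\<^sub>c (\<psi> - exp_op (- 2 * of_real lam) da2 \<psi>))
             + of_real \<omega> \<cdot>\<^sub>c abar2 (da1 \<psi>)
             - (of_real lam / 2 * of_real \<omega>) \<cdot>\<^sub>c abar1 ((da1 ^^ 2) \<psi>))
        \<and> local_rep_act lam \<omega> gen_P1 (exp_emb c \<psi>) = exp_emb c (da1 \<psi>)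
        \<and> local_rep_act lam \<omega> gen_P2 (exp_emb c \<psi>) = exp_emb c (da2 \<psi>))"
proof (intro conjI ballI exp_emb_bij)
  fix \<psi> assume \<psi>: "\<psi> \<in> carrier (U_t lam)"
  \<comment> \<open>\<open>Jdual\<close> is linear over power series in \<phi> and so commutes with
    the factor \<open>fps_exp c\<close>; only \<open>dphi\<close> sees that factor and contributes
    the scalar \<open>c\<close>.\<close>
  have "c \<cdot>\<^sub>c exp_emb c \<psi> + Jdual lam \<omega> (exp_emb c \<psi>) = exp_emb c (c \<cdot>\<^sub>c \<psi> + Jdual lam \<omega> \<psi>)"
    unfolding exp_emb_def phi_linearD(2)[OF Jdual_linear] lmul_add lmul_lmul by (simp only: mult.commute)
  then have "local_rep_act lam \<omega> gen_J (exp_emb c \<psi>) = exp_emb c (c \<cdot>\<^sub>c \<psi> + Jdual lam \<omega> \<psi>)"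
    by (simp only: local_rep_act_def left_act_J dphi_exp_emb[OF \<psi>])
  then show "local_rep_act lam \<omega> gen_J (exp_emb c \<psi>) =
          exp_emb c
            (c \<cdot>\<^sub>c \<psi>
             - abar1 ((1 / (2 * of_real lam)) \<cdot>\<^sub>c (\<psi> - exp_op (- 2 * of_real lam) da2 \<psi>))
             + of_real \<omega> \<cdot>\<^sub>c abar2 (da1 \<psi>)
             - (of_real lam / 2 * of_real \<omega>) \<cdot>\<^sub>c abar1 ((da1 ^^ 2) \<psi>))"
    by (simp add: Jdual_def algebra_simps)
  show "local_rep_act lam \<omega> gen_P1 (exp_emb c \<psi>) = exp_emb c (da1 \<psi>)"
    "local_rep_act lam \<omega> gen_P2 (exp_emb c \<psi>) = exp_emb c (da2 \<psi>)"
    by (simp_all add: local_rep_act_def left_act_P exp_emb_def phi_linearD[OF phi_linear_ops(3)]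
        phi_linearD[OF phi_linear_ops(4)])
qed

end
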